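(* Let $d\ge 1$, let $A\in GL_d(\mathbb{Q})$ have no (complex) eigenvalue of norm $1$, and let $G=\mathbb{Z}\ltimes_A H$, where $H\subset\mathbb{Q}^d$ is a subgroup with $A(H)=H$ and $\mathrm{rank}_{\mathbb{Q}}(H)=d$. Assume that $G$ acts by orientation-preserving homeomorphisms of $[0,1]$ with no global fixed point in $(0,1)$. If the subgroup $H$ acts nontrivially but has a global fixed point inside $(0,1)$, then the action of $G$ cannot be by $C^1$ diffeomorphisms of $[0,1]$.
   Context: The $\mathbb{Q}$-rank of $H$, $\mathrm{rank}_{\mathbb{Q}}(H)$, is the smallest $d'$ such that $H$ embeds into $\mathbb{Q}^{d'}$. $\mathbb{Z}\ltimes_A H$ is the semidirect product in which the generator $a$ of $\mathbb{Z}$ acts on $H$ by $a\,b\,a^{-1}=A(b)$, $b\in H$. A global fixed point of a group is a point fixed by all its elements. *)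

theory Defs
  imports
    "HOL-Analysis.Elementary_Topology"
    "HOL-Algebra.Group_Action"
    "Jordan_Normal_Form.Char_Poly"
begin

abbreviation rat_space :: "nat \<Rightarrow> rat vec monoid" where
  "rat_space d \<equiv> monoid_vec TYPE(rat) d"

abbreviation GL_rat :: "nat \<Rightarrow> rat mat monoid" where
  "GL_rat d \<equiv> units_of (ring_mat TYPE(rat) d ())"

text \<open>
  An embedding is an injective group homomorphism. The value is unspecified if \<open>K\<close> does not embed
  into any $\mathbb{Q}^n$, which cannot happen for a subgroup of some $\mathbb{Q}^d$.
\<close>

definition rat_rank :: "('a, 'b) monoid_scheme \<Rightarrow> nat" where
  "rat_rank K = (LEAST n. \<exists>f. f \<in> mon K (rat_space n))"

text \<open>
  The semidirect product of $\mathbb{Z}$ and $H$. The pair \<open>(m, v)\<close> stands for the product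
  $v\,a^m$, where $a$ is the generator of $\mathbb{Z}$. The exponent of \<open>A\<close> is an integer, and
  the power is taken in $GL_d(\mathbb{Q})$.
\<close>

definition int_semidirect :: "nat \<Rightarrow> rat mat \<Rightarrow> rat vec set \<Rightarrow> (int \<times> rat vec) monoid" where
  "int_semidirect d A H = \<lparr>
     carrier = UNIV \<times> H,
     monoid.mult = (\<lambda>(m, v) (n, w). (m + n, v + (A [^]\<^bsub>GL_rat d\<^esub> m) *\<^sub>v w)),
     one = (0, 0\<^sub>v d)\<rparr>"

definition base_subgroup :: "rat vec set \<Rightarrow> (int \<times> rat vec) set" where
  "base_subgroup H = {0} \<times> H"

text \<open>A homeomorphism of a real interval preserves orientation iff it is increasing.\<close>

definition orientation_preserving_homeo :: "real set \<Rightarrow> (real \<Rightarrow> real) \<Rightarrow> bool" where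
  "orientation_preserving_homeo I f \<longleftrightarrow>
     (\<exists>g. homeomorphism I I f g) \<and> strict_mono_on I f"

text \<open>Derivatives are taken within \<open>I\<close>, so they are one-sided at endpoints that belong to \<open>I\<close>.\<close>

definition C1_on :: "real set \<Rightarrow> (real \<Rightarrow> real) \<Rightarrow> bool" where
  "C1_on I f \<longleftrightarrow>
     (\<exists>f'. (\<forall>x\<in>I. (f has_real_derivative f' x) (at x within I)) \<and> continuous_on I f')"

definition C1_diffeo :: "real set \<Rightarrow> (real \<Rightarrow> real) \<Rightarrow> bool" where
  "C1_diffeo I f \<longleftrightarrow> bij_betw f I I \<and> C1_on I f \<and> C1_on I (inv_into I f)"

definition global_fixed_point :: "('g \<Rightarrow> 'x \<Rightarrow> 'x) \<Rightarrow> 'g set \<Rightarrow> 'x \<Rightarrow> bool" where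
  "global_fixed_point \<phi> K x \<longleftrightarrow> (\<forall>g\<in>K. \<phi> g x = x)"

definition acts_trivially :: "('g \<Rightarrow> 'x \<Rightarrow> 'x) \<Rightarrow> 'g set \<Rightarrow> 'x set \<Rightarrow> bool" where
  "acts_trivially \<phi> K E \<longleftrightarrow> (\<forall>x\<in>E. global_fixed_point \<phi> K x)"

text \<open>
  When \<open>A\<close> maps \<open>H\<close> onto itself, the construction is a group in which conjugation by the
  generator \<open>(1, 0)\<close> acts on \<open>H\<close> as \<open>A\<close>.
\<close>

lemma group_GL_rat: "group (GL_rat d)"
  by (rule monoid.units_group) (rule ring.is_monoid, rule ring_mat)

lemma GL_rat_carrier: "B \<in> carrier (GL_rat d) \<Longrightarrow> B \<in> carrier_mat d d"
  by (auto simp: units_of_def Units_def ring_mat_simps)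

lemma GL_rat_mult: "B \<otimes>\<^bsub>GL_rat d\<^esub> C = B * C"
  by (simp add: units_of_def ring_mat_simps)

lemma GL_rat_one: "\<one>\<^bsub>GL_rat d\<^esub> = 1\<^sub>m d"
  by (simp add: units_of_def ring_mat_simps)

lemma GL_rat_int_pow_image:
  fixes n :: int
  assumes A: "A \<in> carrier (GL_rat d)" and H: "H \<subseteq> carrier_vec d"
    and AH: "(\<lambda>v. A *\<^sub>v v) ` H = H"
  shows "(\<lambda>v. (A [^]\<^bsub>GL_rat d\<^esub> n) *\<^sub>v v) ` H = H"
proof -
  interpret GL: group "GL_rat d" by (rule group_GL_rat)
  have comp: "(\<lambda>v. (B * C) *\<^sub>v v) ` H = (\<lambda>v. B *\<^sub>v v) ` ((\<lambda>v. C *\<^sub>v v) ` H)"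
    if "B \<in> carrier (GL_rat d)" "C \<in> carrier (GL_rat d)" for B C
    unfolding image_image
    by (rule image_cong[OF refl], rule assoc_mult_mat_vec)
       (use that H in \<open>auto dest!: GL_rat_carrier\<close>)
  have one: "(\<lambda>v. 1\<^sub>m d *\<^sub>v v) ` H = H"
    using H by (force simp: image_iff)
  have nat: "(\<lambda>v. (A [^]\<^bsub>GL_rat d\<^esub> k) *\<^sub>v v) ` H = H" for k :: nat
  proof (induction k)
    case 0
    then show ?case by (simp add: GL_rat_one one)
  next
    case (Suc k)
    then show ?case using A by (simp add: GL_rat_mult comp AH)
  qed
  have inv: "(\<lambda>v. (inv\<^bsub>GL_rat d\<^esub> B) *\<^sub>v v) ` H = H"
    if B: "B \<in> carrier (GL_rat d)" and BH: "(\<lambda>v. B *\<^sub>v v) ` H = H" for B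
  proof -
    have "(\<lambda>v. (inv\<^bsub>GL_rat d\<^esub> B * B) *\<^sub>v v) ` H = (\<lambda>v. (inv\<^bsub>GL_rat d\<^esub> B) *\<^sub>v v) ` H"
      using comp[of "inv\<^bsub>GL_rat d\<^esub> B" B] B BH by simp
    moreover have "inv\<^bsub>GL_rat d\<^esub> B * B = 1\<^sub>m d"
      using GL.l_inv[OF B] by (simp add: GL_rat_mult GL_rat_one)
    ultimately show ?thesis by (simp add: one)
  qed
  show ?thesis
  proof (cases "n < 0")
    case True
    then have "A [^]\<^bsub>GL_rat d\<^esub> n = inv\<^bsub>GL_rat d\<^esub> (A [^]\<^bsub>GL_rat d\<^esub> nat (- n))"
      by (simp only: int_pow_def2 if_True)
    then show ?thesis using inv[OF GL.nat_pow_closed[OF A] nat] by (simp only:)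
  next
    case False
    then have "A [^]\<^bsub>GL_rat d\<^esub> n = A [^]\<^bsub>GL_rat d\<^esub> nat n"
      by (simp only: int_pow_def2 if_False)
    then show ?thesis using nat by (simp only:)
  qed
qed

lemma group_int_semidirect:
  assumes A: "A \<in> carrier (GL_rat d)" and H: "subgroup H (rat_space d)"
    and AH: "(\<lambda>v. A *\<^sub>v v) ` H = H"
  shows "group (int_semidirect d A H)"
proof -
  interpret GL: group "GL_rat d" by (rule group_GL_rat)
  interpret Q: comm_group "rat_space d" by (rule comm_group_vec)
  interpret H: subgroup H "rat_space d" by (rule H)
  let ?P = "\<lambda>n::int. A [^]\<^bsub>GL_rat d\<^esub> n"
  have sub: "H \<subseteq> carrier_vec d" using H.subset by (simp add: monoid_vec_def)
  have P_in: "?P n *\<^sub>v v \<in> H" if "v \<in> H" for n v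
    using GL_rat_int_pow_image[OF A sub AH, of n] that by blast
  have P_carr: "?P n \<in> carrier_mat d d" for n
    using A by (intro GL_rat_carrier) simp
  have P_vec: "?P n *\<^sub>v w \<in> carrier_vec d" if "w \<in> carrier_vec d" for n w
    using P_carr that by (rule mult_mat_vec_carrier)
  have P_add: "?P (m + n) = ?P m * ?P n" for m n
    using GL.int_pow_mult[OF A, of m n] by (simp add: GL_rat_mult)
  have P_0: "?P 0 = 1\<^sub>m d" by (simp add: GL_rat_one)
  have P_inv: "?P (- n) *\<^sub>v (?P n *\<^sub>v v) = v" if "v \<in> carrier_vec d" for n v
    using assoc_mult_mat_vec[OF P_carr[of "- n"] P_carr[of n] that] P_add[of "- n" n] P_0 that
    by simp
  have add_in: "v + w \<in> H" if "v \<in> H" "w \<in> H" for v w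
    using H.m_closed[OF that] by (simp add: monoid_vec_def)
  have zero_in: "0\<^sub>v d \<in> H" using H.one_closed by (simp add: monoid_vec_def)
  have neg_in: "\<exists>u\<in>H. u + v = 0\<^sub>v d" if "v \<in> H" for v
    using H.m_inv_closed[OF that] Q.l_inv[of v] that H.subset
    by (intro bexI[of _ "inv\<^bsub>rat_space d\<^esub> v"]) (auto simp: monoid_vec_def)
  show ?thesis
  proof (rule groupI, goal_cases)
    case (1 x y)
    then show ?case by (auto simp: int_semidirect_def intro!: add_in P_in)
  next
    case 2
    then show ?case by (simp add: int_semidirect_def zero_in)
  next
    case (3 x y z)
    obtain m v n w k u where xyz: "x = (m, v)" "y = (n, w)" "z = (k, u)"
      by (cases x, cases y, cases z) auto
    have carr: "v \<in> carrier_vec d" "w \<in> carrier_vec d" "u \<in> carrier_vec d"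
      using 3 xyz sub by (auto simp: int_semidirect_def)
    have "?P m *\<^sub>v (w + ?P n *\<^sub>v u) = ?P m *\<^sub>v w + ?P m *\<^sub>v (?P n *\<^sub>v u)"
      by (rule mult_add_distrib_mat_vec[OF P_carr carr(2) P_vec[OF carr(3)]])
    also have "?P m *\<^sub>v (?P n *\<^sub>v u) = ?P (m + n) *\<^sub>v u"
      using assoc_mult_mat_vec[OF P_carr P_carr carr(3), of m n] by (simp add: P_add)
    finally have *: "?P m *\<^sub>v (w + ?P n *\<^sub>v u) = ?P m *\<^sub>v w + ?P (m + n) *\<^sub>v u" .
    have "v + ?P m *\<^sub>v w + ?P (m + n) *\<^sub>v u = v + (?P m *\<^sub>v w + ?P (m + n) *\<^sub>v u)"
      by (rule assoc_add_vec[OF carr(1) P_vec[OF carr(2)] P_vec[OF carr(3)]])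
    then show ?case using * xyz by (simp add: int_semidirect_def)
  next
    case (4 x)
    then show ?case using sub P_0 by (auto simp: int_semidirect_def)
  next
    case (5 x)
    obtain m v where x: "x = (m, v)" by (cases x)
    then have v: "v \<in> H" using 5 by (simp add: int_semidirect_def)
    obtain u where u: "u \<in> H" "u + ?P (- m) *\<^sub>v v = 0\<^sub>v d"
      using neg_in[OF P_in[OF v]] by blast
    show ?case
      by (rule bexI[of _ "(- m, u)"]) (use u x in \<open>auto simp: int_semidirect_def\<close>)
  qed
qed

lemma int_semidirect_conj:
  assumes A: "A \<in> carrier (GL_rat d)" and H: "subgroup H (rat_space d)"
    and AH: "(\<lambda>v. A *\<^sub>v v) ` H = H" and v: "v \<in> H"
  defines "G \<equiv> int_semidirect d A H"
  shows "(1, 0\<^sub>v d) \<otimes>\<^bsub>G\<^esub> (0, v) \<otimes>\<^bsub>G\<^esub> inv\<^bsub>G\<^esub> (1, 0\<^sub>v d) = (0, A *\<^sub>v v)"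
proof -
  interpret G: group G unfolding G_def by (rule group_int_semidirect) fact+
  interpret GL: group "GL_rat d" by (rule group_GL_rat)
  have zero: "0\<^sub>v d \<in> H" using subgroup.one_closed[OF H] by (simp add: monoid_vec_def)
  have Av: "A *\<^sub>v v \<in> H" using AH v by blast
  have sub: "H \<subseteq> carrier_vec d" using subgroup.subset[OF H] by (simp add: monoid_vec_def)
  have P1: "A [^]\<^bsub>GL_rat d\<^esub> (1::int) = A" using A by (rule GL.int_pow_1)
  have P0: "A [^]\<^bsub>GL_rat d\<^esub> (0::int) = 1\<^sub>m d" by (simp add: GL_rat_one)
  have in_G: "(n, w) \<in> carrier G" if "w \<in> H" for n w
    using that by (simp add: G_def int_semidirect_def)
  have "(1, 0\<^sub>v d) \<otimes>\<^bsub>G\<^esub> (0, v) = (0, A *\<^sub>v v) \<otimes>\<^bsub>G\<^esub> (1, 0\<^sub>v d)"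
    using Av sub P1 P0 by (auto simp: G_def int_semidirect_def)
  then show ?thesis
    by (rule iffD2[OF G.inv_solve_right'[OF in_G[OF Av]
          G.m_closed[OF in_G[OF zero] in_G[OF v]] in_G[OF zero]]])
qed

end

theory Submission
  imports Defs "HOL-Analysis.Elementary_Metric_Spaces" "Jordan_Normal_Form.Schur_Decomposition"
begin

text \<open>
  Suppose the action is by \<open>C\<^sup>1\<close> diffeomorphisms. Let \<open>(p, q)\<close> be a component of the complement of
  the fixed points of \<open>H\<close>, and let \<open>f\<close> be the action of the generator of \<open>\<int>\<close>. Since \<open>G\<close> has no
  interior global fixed point, the intervals \<open>f\<^sup>n (p, q)\<close> are disjoint and shrink to a point \<open>w\<close> as
  \<open>n\<close> tends to infinity, and likewise for negative \<open>n\<close>. Hoelder's construction, applied to the orbit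
  of a point \<open>x\<^sub>0\<close> of \<open>(p, q)\<close>, yields a nonzero homomorphism \<open>\<tau>\<close> from \<open>H\<close> to the reals such that
  \<open>\<tau> h > 0\<close> implies \<open>h x\<^sub>0 > x\<^sub>0\<close>.

  Put \<open>x\<^sub>n = f\<^sup>n x\<^sub>0\<close>. Elements of \<open>H\<close> have derivative 1 at \<open>w\<close>, so the displacement
  \<open>h x\<^sub>n - x\<^sub>n\<close> is asymptotically additive in \<open>h\<close>. It is positive where \<open>\<tau> (A\<^sup>-\<^sup>n h)\<close> is, so after
  normalization both functionals have the same limit behaviour. Under \<open>n \<mapsto> n + 1\<close> the displacement
  gains the factor \<open>f' w\<close>, and so does the length of \<open>f\<^sup>n (p, q)\<close>, which bounds it. Hence
  \<open>\<tau> \<circ> A\<^sup>-\<^sup>n\<close> grows subexponentially, and by symmetry so does \<open>\<tau> \<circ> A\<^sup>n\<close>. As \<open>A\<close> has no eigenvalue of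
  norm 1, this forces \<open>\<tau> = 0\<close>.
\<close>

section \<open>Hoelder's construction\<close>

text \<open>Read \<open>N\<close> as the nonnegative cone of a translation-invariant total preorder
  in which \<open>e\<close> is positive with cofinal powers. In additive notation,
  \<open>\<tau> g\<close> is the supremum of the fractions \<open>m / n\<close> with
  \<open>m e \<le> n g\<close>. Elements infinitesimal relative to \<open>e\<close> get the value 0,
  so the last conclusion is an implication in one direction.\<close>

lemma (in comm_group) exists_translation_hom:
  fixes e :: 'a and N :: "'a set"
  assumes N: "N \<subseteq> carrier G" and one_N: "\<one> \<in> N"
    and mult_N: "\<And>g h. g \<in> N \<Longrightarrow> h \<in> N \<Longrightarrow> g \<otimes> h \<in> N"
    and total_N: "\<And>g. g \<in> carrier G \<Longrightarrow> g \<in> N \<or> inv g \<in> N"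
    and e: "e \<in> carrier G" "inv e \<notin> N"
    and arch: "\<And>g. g \<in> carrier G \<Longrightarrow> \<exists>m::nat. e [^] m \<otimes> inv g \<in> N"
  obtains \<tau> :: "'a \<Rightarrow> real"
  where "\<And>g h. g \<in> carrier G \<Longrightarrow> h \<in> carrier G \<Longrightarrow> \<tau> (g \<otimes> h) = \<tau> g + \<tau> h"
    and "\<tau> e = 1" and "\<And>g. g \<in> carrier G \<Longrightarrow> \<tau> g > 0 \<Longrightarrow> inv g \<notin> N"
proof -
  define S where "S g = {real_of_int m / real n | m n. n > 0 \<and> g [^] n \<otimes> inv (e [^] m) \<in> N}"
    for g
  define \<tau> where "\<tau> g = Sup (S g)" for g
  have pow_N: "g [^] (n::nat) \<in> N" if "g \<in> N" for g n
    by (induction n) (use that one_N mult_N N in auto)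
  have e_N: "e \<in> N" using total_N e by blast
  have e_pow: "e [^] (m::int) \<in> N \<longleftrightarrow> m \<ge> 0" for m
  proof
    assume a: "e [^] m \<in> N"
    show "m \<ge> 0"
    proof (rule ccontr)
      assume "\<not> m \<ge> 0"
      \<comment> \<open>With this \<open>k\<close> the product of \<open>e [^] m\<close> and
        \<open>e [^] k\<close> is \<open>inv e\<close>, which lies outside \<open>N\<close>.\<close>
      define k where "k = nat (- 1 - m)"
      then have k: "m = - 1 - int k" using \<open>\<not> m \<ge> 0\<close> by simp
      have "e [^] m \<otimes> e [^] (int k) \<in> N" using mult_N[OF a] pow_N[OF e_N] by (simp add: int_pow_int)
      moreover have "e [^] m \<otimes> e [^] (int k) = inv e"
        using e by (simp add: int_pow_mult[symmetric] k int_pow_neg)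
      ultimately show False using e by simp
    qed
  next
    assume "m \<ge> 0"
    then show "e [^] m \<in> N" using pow_N[OF e_N, of "nat m"] by (simp add: pow_nat)
  qed
  have S_I: "real_of_int m / real n \<in> S g" if "n > 0" "g [^] n \<otimes> inv (e [^] m) \<in> N" for g m n
    using that by (auto simp: S_def)
  have S_nonempty: "S g \<noteq> {}" if g: "g \<in> carrier G" for g
  proof -
    obtain m :: nat where "e [^] m \<otimes> inv (inv g) \<in> N" using arch[of "inv g"] g by auto
    then have "g [^] (1::nat) \<otimes> inv (e [^] (- int m)) \<in> N"
      using g e by (simp add: int_pow_neg int_pow_int m_comm)
    then show ?thesis using S_I[of 1 g "- int m"] by auto
  qed
  have S_bdd: "bdd_above (S g)" if g: "g \<in> carrier G" for g
  proof -
    obtain k :: nat where k: "e [^] k \<otimes> inv g \<in> N" using arch g by auto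
    \<comment> \<open>In additive notation, \<open>g \<le> k e\<close> and
      \<open>m e \<le> n g\<close> combine to \<open>m e \<le> k n e\<close>, and multiples of
      \<open>e\<close> are ordered like their coefficients.\<close>
    have "m / n \<le> k" if "n > 0" and *: "g [^] n \<otimes> inv (e [^] m) \<in> N" for m :: int and n :: nat
    proof -
      have "(e [^] k \<otimes> inv g) [^] n \<in> N" using pow_N k by auto
      also have "(e [^] k \<otimes> inv g) [^] n = e [^] (k * n) \<otimes> inv (g [^] n)"
        using pow_mult_distrib[OF m_comm, of "e [^] k" "inv g" n] e g
        by (simp add: nat_pow_pow nat_pow_inv)
      finally have "e [^] (k * n) \<otimes> inv (g [^] n) \<otimes> (g [^] n \<otimes> inv (e [^] m)) \<in> N"
        using mult_N * by blast
      also have "e [^] (k * n) \<otimes> inv (g [^] n) \<otimes> (g [^] n \<otimes> inv (e [^] m)) = e [^] (k * n) \<otimes> inv (e [^] m)"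
        using e g by (simp add: m_assoc flip: m_assoc[of "inv (g [^] n)" "g [^] n"])
      also have "\<dots> = e [^] (int (k * n) - m)"
        using e by (simp only: int_pow_diff int_pow_int)
      finally have "m \<le> int (k * n)" by (simp add: e_pow)
      then have "real_of_int m \<le> k * n" by (metis of_int_le_iff of_int_of_nat_eq of_nat_mult)
      then show ?thesis using that by (simp add: field_simps)
    qed
    then show ?thesis unfolding S_def bdd_above_def by auto
  qed
  have S_add: "r + s \<in> S (g \<otimes> h)"
    if g: "g \<in> carrier G" and h: "h \<in> carrier G" and "r \<in> S g" and "s \<in> S h" for r s g h
  proof -
    obtain m n where r: "r = real_of_int m / real n" "n > 0" "g [^] n \<otimes> inv (e [^] m) \<in> N"
      using \<open>r \<in> S g\<close> by (auto simp: S_def)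
    obtain k l where s: "s = real_of_int k / real l" "l > 0" "h [^] l \<otimes> inv (e [^] k) \<in> N"
      using \<open>s \<in> S h\<close> by (auto simp: S_def)
    have pw: "(a [^] n \<otimes> inv (e [^] m)) [^] l = a [^] (n * l) \<otimes> inv (e [^] (m * l))"
      if "a \<in> carrier G" for a and n l :: nat and m :: int
    proof -
      have "(a [^] n \<otimes> inv (e [^] m)) [^] l = (a [^] n) [^] l \<otimes> inv ((e [^] m) [^] l)"
        using pow_mult_distrib[OF m_comm, of "a [^] n" "inv (e [^] m)" l] e that
        by (simp add: nat_pow_inv)
      then show ?thesis using e that by (metis int_pow_int int_pow_pow nat_pow_pow)
    qed
    \<comment> \<open>The powers \<open>l\<close> and \<open>n\<close> bring the two fractions to
      the common denominator \<open>n * l\<close>.\<close>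
    have "(g [^] n \<otimes> inv (e [^] m)) [^] l \<otimes> (h [^] l \<otimes> inv (e [^] k)) [^] n \<in> N"
      using mult_N pow_N r s by blast
    also have "(g [^] n \<otimes> inv (e [^] m)) [^] l \<otimes> (h [^] l \<otimes> inv (e [^] k)) [^] n
        = (g [^] (n * l) \<otimes> h [^] (l * n)) \<otimes> (inv (e [^] (m * l)) \<otimes> inv (e [^] (k * n)))"
      unfolding pw[OF g] pw[OF h] using e g h by (simp add: m_ac)
    also have "g [^] (n * l) \<otimes> h [^] (l * n) = (g \<otimes> h) [^] (n * l)"
      using g h by (simp add: pow_mult_distrib m_comm mult.commute)
    also have "inv (e [^] (m * l)) \<otimes> inv (e [^] (k * n)) = inv (e [^] (m * l + k * n))"
      using e by (simp add: int_pow_mult inv_mult)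
    finally have "real_of_int (m * l + k * n) / real (n * l) \<in> S (g \<otimes> h)"
      using r s by (intro S_I) auto
    moreover have "r + s = real_of_int (m * l + k * n) / real (n * l)"
      using r s by (simp add: field_simps)
    ultimately show ?thesis by simp
  qed
  \<comment> \<open>Suprema of sums give superadditivity only. Additivity follows once
    \<open>\<tau>\<close> is known to change sign under inversion.\<close>
  have super: "\<tau> g + \<tau> h \<le> \<tau> (g \<otimes> h)" if g: "g \<in> carrier G" and h: "h \<in> carrier G" for g h
  proof -
    have le: "r + s \<le> \<tau> (g \<otimes> h)" if "r \<in> S g" "s \<in> S h" for r s
      unfolding \<tau>_def using S_add[OF g h that] S_bdd g h by (intro cSup_upper) auto
    have "\<tau> g \<le> \<tau> (g \<otimes> h) - s" if "s \<in> S h" for s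
      unfolding \<tau>_def[of g] using le that S_nonempty g by (intro cSup_least) (auto simp: field_simps)
    then have "\<tau> h \<le> \<tau> (g \<otimes> h) - \<tau> g"
      unfolding \<tau>_def[of h] using S_nonempty h by (intro cSup_least) (auto simp: field_simps)
    then show ?thesis by simp
  qed
  have S_one: "S \<one> = {real_of_int m / real n | m n. n > 0 \<and> m \<le> 0}"
    unfolding S_def using e e_pow by (simp flip: int_pow_neg)
  have "\<tau> \<one> \<le> 0"
    unfolding \<tau>_def by (rule cSup_least) (use S_nonempty S_one in \<open>auto intro: divide_nonpos_nonneg\<close>)
  moreover have "\<tau> \<one> \<ge> 0"
    unfolding \<tau>_def using S_bdd[of \<one>] S_I[of 1 \<one> 0] one_N by (intro cSup_upper) auto
  ultimately have \<tau>_one: "\<tau> \<one> = 0" by simp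
  have inv_ge: "\<tau> (inv g) \<ge> - \<tau> g" if g: "g \<in> carrier G" for g
  proof (rule ccontr)
    assume "\<not> \<tau> (inv g) \<ge> - \<tau> g"
    \<comment> \<open>A rational \<open>r\<close> in the supposed gap is not in \<open>S g\<close>,
      so by totality of the preorder \<open>- r\<close> is in \<open>S (inv g)\<close>, although it
      exceeds the supremum of that set.\<close>
    then obtain r where r: "r \<in> \<rat>" "\<tau> g < r" "r < - \<tau> (inv g)"
      using Rats_dense_in_real[of "\<tau> g" "- \<tau> (inv g)"] by auto
    obtain m :: int and n :: nat where mn: "n > 0" "r = real_of_int m / real n"
    proof -
      obtain a b :: int where ab: "b > 0" "r = of_int a / of_int b" using r(1) by (rule Rats_cases')
      show ?thesis by (rule that[of "nat b" a]) (use ab in auto)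
    qed
    have "r \<notin> S g" using cSup_upper[OF _ S_bdd[OF g], of r] r by (auto simp: \<tau>_def)
    then have "g [^] n \<otimes> inv (e [^] m) \<notin> N" using S_I mn by blast
    then have "inv (g [^] n \<otimes> inv (e [^] m)) \<in> N" using total_N[of "g [^] n \<otimes> inv (e [^] m)"] g e by blast
    also have "inv (g [^] n \<otimes> inv (e [^] m)) = inv g [^] n \<otimes> inv (e [^] (- m))"
      using g e by (simp add: inv_mult nat_pow_inv int_pow_neg m_comm)
    finally have "- r \<in> S (inv g)" using S_I[of n "inv g" "- m"] mn by simp
    then have "- r \<le> \<tau> (inv g)" unfolding \<tau>_def using S_bdd g by (intro cSup_upper) auto
    then show False using r by simp
  qed
  have \<tau>_inv: "\<tau> (inv g) = - \<tau> g" if g: "g \<in> carrier G" for g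
    using inv_ge[OF g] super[OF g, of "inv g"] g \<tau>_one by simp
  show ?thesis
  proof
    fix g h assume g: "g \<in> carrier G" and h: "h \<in> carrier G"
    \<comment> \<open>Superadditivity for \<open>g \<otimes> h\<close> and \<open>inv h\<close> is
      the missing inequality.\<close>
    have "\<tau> (g \<otimes> h) + \<tau> (inv h) \<le> \<tau> (g \<otimes> h \<otimes> inv h)" using super g h by simp
    moreover have "g \<otimes> h \<otimes> inv h = g" using g h by (simp add: m_assoc)
    ultimately show "\<tau> (g \<otimes> h) = \<tau> g + \<tau> h" using super[OF g h] \<tau>_inv[OF h] by simp
  next
    have S_e: "S e = {real_of_int m / real n | m n. n > 0 \<and> m \<le> int n}"
    proof -
      have "e [^] n \<otimes> inv (e [^] m) = e [^] (int n - m)" for n :: nat and m :: int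
        using e by (simp only: int_pow_diff int_pow_int)
      then show ?thesis unfolding S_def by (simp add: e_pow)
    qed
    have "\<tau> e \<le> 1"
      unfolding \<tau>_def by (rule cSup_least) (use S_nonempty[of e] e S_e in auto)
    moreover have "\<tau> e \<ge> 1"
      unfolding \<tau>_def using S_bdd[of e] e S_e
      by (intro cSup_upper) (auto intro!: exI[of _ 1] exI[of _ "1::nat"])
    ultimately show "\<tau> e = 1" by simp
  next
    fix g assume g: "g \<in> carrier G" and pos: "\<tau> g > 0"
    then obtain r where "r \<in> S g" "r > 0"
      using less_cSupD[OF S_nonempty[OF g], of 0] by (auto simp: \<tau>_def)
    then obtain m :: int and n :: nat where mn: "n > 0" "m > 0" "g [^] n \<otimes> inv (e [^] m) \<in> N"
      by (fastforce simp: S_def zero_less_divide_iff)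
    show "inv g \<notin> N"
    proof
      assume "inv g \<in> N"
      then have "inv g [^] n \<otimes> (g [^] n \<otimes> inv (e [^] m)) \<in> N" using pow_N mn mult_N by blast
      also have "inv g [^] n \<otimes> (g [^] n \<otimes> inv (e [^] m)) = e [^] (- m)"
        using g e by (simp add: nat_pow_inv int_pow_neg m_assoc[symmetric])
      finally show False using mn e_pow[of "- m"] by simp
    qed
  qed
qed

section \<open>Sequences of unit vectors\<close>

lemma abs_le_1_if_sum_sq:
  fixes f :: "nat \<Rightarrow> real"
  assumes "(\<Sum>j<d. (f j)\<^sup>2) = 1" "j < d"
  shows "\<bar>f j\<bar> \<le> 1"
proof -
  have "(f j)\<^sup>2 \<le> (\<Sum>j<d. (f j)\<^sup>2)" using assms by (intro member_le_sum) auto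
  then show ?thesis using assms(1) by (simp add: abs_square_le_1)
qed

lemma tendsto_Bseq_mult_zero:
  fixes f g :: "nat \<Rightarrow> real"
  assumes "f \<longlonglongrightarrow> 0" "Bseq g"
  shows "(\<lambda>n. f n * g n) \<longlonglongrightarrow> 0"
  using bounded_bilinear.Zfun_prod_Bfun[OF bounded_bilinear_mult, of f sequentially g] assms
  by (simp add: tendsto_Zfun_iff)

lemma Bseq_if_diff_tendsto:
  fixes f g :: "nat \<Rightarrow> real"
  assumes "(\<lambda>n. f n - g n) \<longlonglongrightarrow> 0" "Bseq g"
  shows "Bseq f"
proof -
  obtain K L where "\<And>n. norm (f n - g n) \<le> K" "\<And>n. norm (g n) \<le> L"
    using convergent_imp_Bseq[OF convergentI[OF assms(1)]] assms(2) by (auto simp: Bseq_def)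
  then have "norm (f n) \<le> K + L" for n
    using norm_triangle_ineq[of "f n - g n" "g n"] by (smt (verit) diff_add_cancel)
  then show ?thesis by (rule BseqI')
qed

text \<open>Bolzano-Weierstrass, one coordinate after the other. The dimension \<open>d\<close> is a
  variable, so vectors are functions on the naturals of which only the values below \<open>d\<close>
  count.\<close>

lemma bounded_family_convergent_subseq:
  fixes X :: "nat \<Rightarrow> nat \<Rightarrow> real"
  assumes "\<And>n j. j < d \<Longrightarrow> \<bar>X n j\<bar> \<le> B"
  obtains r l where "strict_mono r" "\<And>j. j < d \<Longrightarrow> (\<lambda>n. X (r n) j) \<longlonglongrightarrow> l j"
proof -
  have "\<exists>r l. strict_mono r \<and> (\<forall>j<d. (\<lambda>n. X (r n) j) \<longlonglongrightarrow> l j)"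
    using assms
  proof (induction d)
    case 0
    show ?case by (rule exI[of _ id]) (simp add: strict_mono_def)
  next
    case (Suc d)
    have "\<exists>r l. strict_mono r \<and> (\<forall>j<d. (\<lambda>n. X (r n) j) \<longlonglongrightarrow> l j)"
      using Suc.prems by (intro Suc.IH) simp
    then obtain r l where r: "strict_mono (r :: nat \<Rightarrow> nat)" "\<And>j. j < d \<Longrightarrow> (\<lambda>n. X (r n) j) \<longlonglongrightarrow> l j"
      by blast
    have "bounded (range (\<lambda>n. X (r n) d))"
      using Suc.prems[of d] by (auto simp: bounded_iff)
    then obtain m r' where r': "strict_mono r'" "((\<lambda>n. X (r n) d) \<circ> r') \<longlonglongrightarrow> m"
      using bounded_imp_convergent_subsequence by blast
    have "(\<lambda>n. X ((r \<circ> r') n) j) \<longlonglongrightarrow> (l(d := m)) j" if "j < Suc d" for j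
    proof (cases "j = d")
      case True
      then show ?thesis using r'(2) by (simp add: o_def)
    next
      case False
      then show ?thesis using that LIMSEQ_subseq_LIMSEQ[OF r(2) r'(1), of j] by (simp add: o_def)
    qed
    then show ?case using strict_mono_o[OF r(1) r'(1)] by blast
  qed
  then show ?thesis using that by blast
qed

text \<open>
  The vector \<open>- z + (s + \<epsilon>) y\<close> with \<open>s = z \<bullet> y\<close> lies in the half space of \<open>y\<close> and tests the equality
  case of the Cauchy--Schwarz inequality.
\<close>

lemma unit_vectors_eq_if_half_spaces:
  fixes y z :: "nat \<Rightarrow> real"
  assumes y: "(\<Sum>j<d. (y j)\<^sup>2) = 1" and z: "(\<Sum>j<d. (z j)\<^sup>2) = 1"
    and half: "\<And>m :: nat \<Rightarrow> int. (\<Sum>j<d. m j * y j) > 0 \<Longrightarrow> (\<Sum>j<d. m j * z j) \<ge> 0"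
    and j: "j < d"
  shows "z j = y j"
proof -
  have half_real: "(\<Sum>j<d. x j * z j) \<ge> 0" if x: "(\<Sum>j<d. x j * y j) > 0" for x :: "nat \<Rightarrow> real"
  proof -
    \<comment> \<open>Integer vectors test enough directions: the rounded multiples of
      \<open>x\<close>, scaled back by \<open>Suc k\<close>, converge to \<open>x\<close>, and a
      positive scaling does not change signs.\<close>
    define m where "m k j = \<lfloor>real (Suc k) * x j\<rfloor>" for k j
    have lim: "(\<lambda>k. m k j / real (Suc k)) \<longlonglongrightarrow> x j" for j
    proof (rule LIMSEQ_I)
      fix e :: real assume "e > 0"
      then obtain N where N: "1 / real (Suc N) < e" using nat_approx_posE by blast
      have "norm (m k j / real (Suc k) - x j) < e" if "k \<ge> N" for k
      proof -
        have "m k j / real (Suc k) - x j = - (real (Suc k) * x j - m k j) / real (Suc k)"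
          by (simp add: field_simps)
        moreover have "0 \<le> real (Suc k) * x j - m k j" "real (Suc k) * x j - m k j < 1"
          unfolding m_def by linarith+
        ultimately have "norm (m k j / real (Suc k) - x j) \<le> 1 / real (Suc k)"
          by (simp add: divide_right_mono del: of_nat_Suc)
        also have "\<dots> \<le> 1 / real (Suc N)" using that by (simp add: frac_le)
        finally show ?thesis using N by simp
      qed
      then show "\<exists>no. \<forall>k\<ge>no. norm (m k j / real (Suc k) - x j) < e" by blast
    qed
    have dv: "(\<Sum>j<d. m k j / real (Suc k) * w j) = (\<Sum>j<d. m k j * w j) / real (Suc k)" for k and w :: "nat \<Rightarrow> real"
      by (simp add: sum_divide_distrib)
    have lim_sum: "(\<lambda>k. \<Sum>j<d. m k j / real (Suc k) * w j) \<longlonglongrightarrow> (\<Sum>j<d. x j * w j)" for w :: "nat \<Rightarrow> real"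
      by (intro tendsto_sum tendsto_mult lim tendsto_const)
    have "\<forall>\<^sub>F k in sequentially. (\<Sum>j<d. m k j / real (Suc k) * y j) > 0"
      using order_tendstoD(1)[OF lim_sum x] .
    then have "\<forall>\<^sub>F k in sequentially. (\<Sum>j<d. m k j / real (Suc k) * z j) \<ge> 0"
    proof (rule eventually_mono)
      fix k assume "(\<Sum>j<d. m k j / real (Suc k) * y j) > 0"
      then have "(\<Sum>j<d. m k j * y j) > 0" unfolding dv by (simp add: zero_less_divide_iff del: of_nat_Suc)
      then show "(\<Sum>j<d. m k j / real (Suc k) * z j) \<ge> 0" unfolding dv using half[of "m k"] by simp
    qed
    then show ?thesis using lim_sum tendsto_lowerbound trivial_limit_sequentially by blast
  qed
  define s where "s = (\<Sum>j<d. z j * y j)"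
  have s0: "s \<ge> 0" using half_real[of y] y by (simp add: s_def power2_eq_square mult.commute)
  have "s \<ge> 1"
  proof (rule ccontr)
    assume "\<not> s \<ge> 1"
    then have s1: "s < 1" by simp
    define e where "e = (1 - s\<^sup>2) / 2"
    have s2: "s\<^sup>2 < 1" using s0 s1 by (simp add: abs_square_less_1)
    then have e: "e > 0" by (simp add: e_def)
    have lin: "(\<Sum>j<d. (- z j + (s + e) * y j) * w j) = - (\<Sum>j<d. z j * w j) + (s + e) * (\<Sum>j<d. y j * w j)"
      for w :: "nat \<Rightarrow> real"
      by (simp only: distrib_right[of "- z _"] sum.distrib mult.assoc sum_distrib_left[symmetric]
          mult_minus_left sum_negf)
    have yy: "(\<Sum>j<d. y j * y j) = 1" and zz: "(\<Sum>j<d. z j * z j) = 1"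
      using y z by (simp_all add: power2_eq_square)
    have yz: "(\<Sum>j<d. y j * z j) = s" by (simp add: s_def mult.commute)
    have "(\<Sum>j<d. (- z j + (s + e) * y j) * y j) > 0" unfolding lin yy using e by (simp add: s_def)
    then have "(\<Sum>j<d. (- z j + (s + e) * y j) * z j) \<ge> 0" by (rule half_real)
    then have "- 1 + (s + e) * s \<ge> 0" unfolding lin zz yz .
    moreover have "e * s \<le> e" using e s1 by simp
    moreover have "2 * e = 1 - s\<^sup>2" by (simp add: e_def)
    moreover have "(s + e) * s = s\<^sup>2 + e * s" by (simp add: power2_eq_square algebra_simps)
    ultimately show False using s2 by linarith
  qed
  moreover have "(\<Sum>j<d. (z j - y j)\<^sup>2) = 2 - 2 * s"
    using y z by (simp add: power2_diff sum.distrib sum_subtractf s_def sum_distrib_left mult.assoc)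
  moreover have "(z j - y j)\<^sup>2 \<le> (\<Sum>j<d. (z j - y j)\<^sup>2)" using j by (intro member_le_sum) auto
  ultimately have "(z j - y j)\<^sup>2 \<le> 0" by linarith
  then show ?thesis by simp
qed

text \<open>By compactness: if the difference stays away from 0 along a subsequence, a further
  subsequence makes both families converge, and the errors vanish in the limit. The limits then
  satisfy the exact half-space condition and must coincide. Each \<open>m\<close> enters the limit
  separately, so \<open>E\<close> may depend on \<open>m\<close>.\<close>

lemma unit_vectors_diff_tendsto_0:
  fixes Y Z :: "nat \<Rightarrow> nat \<Rightarrow> real"
  assumes Y: "\<And>n. (\<Sum>j<d. (Y n j)\<^sup>2) = 1" and Z: "\<And>n. (\<Sum>j<d. (Z n j)\<^sup>2) = 1"
    and half: "\<And>m :: nat \<Rightarrow> int. \<exists>E. E \<longlonglongrightarrow> 0 \<and>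
      (\<forall>n. (\<Sum>j<d. m j * Y n j) > 0 \<longrightarrow> (\<Sum>j<d. m j * Z n j) \<ge> E n)"
    and j: "j < d"
  shows "(\<lambda>n. Z n j - Y n j) \<longlonglongrightarrow> 0"
proof (rule ccontr)
  assume "\<not> ?thesis"
  then obtain \<delta> where \<delta>: "\<delta> > 0" "\<And>N. \<exists>n\<ge>N. \<bar>Z n j - Y n j\<bar> \<ge> \<delta>"
    unfolding LIMSEQ_def by (auto simp: not_less)
  have inf: "infinite {n. \<bar>Z n j - Y n j\<bar> \<ge> \<delta>}"
    unfolding infinite_nat_iff_unbounded_le using \<delta>(2) by auto
  define r where "r = enumerate {n. \<bar>Z n j - Y n j\<bar> \<ge> \<delta>}"
  have r: "strict_mono r" unfolding r_def by (rule strict_mono_enumerate[OF inf])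
  have r_ge: "\<bar>Z (r n) j - Y (r n) j\<bar> \<ge> \<delta>" for n
    using enumerate_in_set[OF inf, of n] by (simp add: r_def)
  have bound_Y: "\<bar>Y n i\<bar> \<le> 1" and bound_Z: "\<bar>Z n i\<bar> \<le> 1" if "i < d" for n i
    using abs_le_1_if_sum_sq[OF Y that] abs_le_1_if_sum_sq[OF Z that] by blast+
  obtain r1 y where r1: "strict_mono (r1 :: nat \<Rightarrow> nat)" "\<And>j. j < d \<Longrightarrow> (\<lambda>n. Y (r (r1 n)) j) \<longlonglongrightarrow> y j"
    using bounded_family_convergent_subseq[of d "\<lambda>n. Y (r n)" 1] bound_Y by blast
  obtain r2 z where r2: "strict_mono (r2 :: nat \<Rightarrow> nat)" "\<And>j. j < d \<Longrightarrow> (\<lambda>n. Z (r (r1 (r2 n))) j) \<longlonglongrightarrow> z j"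
    using bounded_family_convergent_subseq[of d "\<lambda>n. Z (r (r1 n))" 1] bound_Z by blast
  define q where "q n = r (r1 (r2 n))" for n
  have q: "strict_mono q" using r r1 r2 by (simp add: q_def strict_mono_def)
  have Zq: "(\<lambda>n. Z (q n) j) \<longlonglongrightarrow> z j" if "j < d" for j using r2 that by (simp add: q_def)
  have Yq: "(\<lambda>n. Y (q n) j) \<longlonglongrightarrow> y j" if "j < d" for j
    using LIMSEQ_subseq_LIMSEQ[OF r1(2)[OF that] r2(1)] by (simp add: q_def o_def)
  have "(\<lambda>n. \<Sum>j<d. (Y (q n) j)\<^sup>2) \<longlonglongrightarrow> (\<Sum>j<d. (y j)\<^sup>2)"
    by (intro tendsto_sum tendsto_power Yq) simp
  then have y1: "(\<Sum>j<d. (y j)\<^sup>2) = 1" by (simp add: Y LIMSEQ_const_iff)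
  have "(\<lambda>n. \<Sum>j<d. (Z (q n) j)\<^sup>2) \<longlonglongrightarrow> (\<Sum>j<d. (z j)\<^sup>2)"
    by (intro tendsto_sum tendsto_power Zq) simp
  then have z1: "(\<Sum>j<d. (z j)\<^sup>2) = 1" by (simp add: Z LIMSEQ_const_iff)
  have "(\<Sum>j<d. m j * z j) \<ge> 0" if m: "(\<Sum>j<d. m j * y j) > 0" for m :: "nat \<Rightarrow> int"
  proof -
    obtain E where E: "E \<longlonglongrightarrow> 0" "\<And>n. (\<Sum>j<d. m j * Y n j) > 0 \<Longrightarrow> (\<Sum>j<d. m j * Z n j) \<ge> E n"
      using half by blast
    have "(\<lambda>n. \<Sum>j<d. m j * Y (q n) j) \<longlonglongrightarrow> (\<Sum>j<d. m j * y j)"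
      by (intro tendsto_sum tendsto_mult tendsto_const Yq) simp
    from order_tendstoD(1)[OF this m]
    have ev: "\<forall>\<^sub>F n in sequentially. E (q n) \<le> (\<Sum>j<d. m j * Z (q n) j)"
      by (rule eventually_mono) (rule E(2))
    have "(\<lambda>n. \<Sum>j<d. m j * Z (q n) j) \<longlonglongrightarrow> (\<Sum>j<d. m j * z j)"
      by (intro tendsto_sum tendsto_mult tendsto_const Zq) simp
    moreover have "(\<lambda>n. E (q n)) \<longlonglongrightarrow> 0" using LIMSEQ_subseq_LIMSEQ[OF E(1) q] by (simp add: o_def)
    ultimately show ?thesis using tendsto_le[OF trivial_limit_sequentially _ _ ev] by blast
  qed
  then have "z j = y j" by (rule unit_vectors_eq_if_half_spaces[OF y1 z1 _ j])
  then have "(\<lambda>n. Z (q n) j - Y (q n) j) \<longlonglongrightarrow> 0" using tendsto_diff[OF Zq[OF j] Yq[OF j]] by simp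
  then have "(\<lambda>n. \<bar>Z (q n) j - Y (q n) j\<bar>) \<longlonglongrightarrow> 0" by (rule tendsto_rabs_zero)
  then have "\<delta> \<le> 0" using r_ge by (intro LIMSEQ_le_const) (auto simp: q_def)
  then show False using \<delta> by simp
qed

text \<open>From some index \<open>N\<close> on, each step multiplies by less than \<open>r\<close>.
  The sum of the terms up to \<open>N\<close> is a constant that absorbs the start.\<close>

lemma subexponential_if_ratio_tendsto_1:
  fixes s :: "nat \<Rightarrow> real"
  assumes pos: "\<And>n. s n > 0" and ratio: "(\<lambda>n. s (Suc n) / s n) \<longlonglongrightarrow> 1" and r: "r > 1"
  obtains C where "\<And>n. s n \<le> C * r ^ n"
proof -
  obtain N where N: "\<And>n. n \<ge> N \<Longrightarrow> s (Suc n) / s n < r"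
    using order_tendstoD(2)[OF ratio r] by (auto simp: eventually_sequentially)
  define C where "C = (\<Sum>i\<le>N. s i)"
  have C: "s i \<le> C" if "i \<le> N" for i
    unfolding C_def using that pos by (intro member_le_sum) (auto intro: less_imp_le)
  have C0: "C \<ge> 0" unfolding C_def using pos by (intro sum_nonneg) (auto intro: less_imp_le)
  have "s n \<le> C * r ^ n" for n
  proof (induction n)
    case 0
    show ?case using C[of 0] by simp
  next
    case (Suc n)
    show ?case
    proof (cases "Suc n \<le> N")
      case True
      have "s (Suc n) \<le> C * 1" using C[OF True] by simp
      also have "\<dots> \<le> C * r ^ Suc n" using C0 r by (intro mult_left_mono one_le_power) auto
      finally show ?thesis .
    next
      case False
      then have "s (Suc n) \<le> r * s n" using N[of n] pos[of n] by (simp add: field_simps)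
      also have "\<dots> \<le> r * (C * r ^ n)" using Suc.IH r by simp
      finally show ?thesis by (simp add: mult_ac)
    qed
  qed
  then show ?thesis by (rule that)
qed

section \<open>Subexponential orbits of hyperbolic matrices\<close>

definition bi_subexponential :: "(int \<Rightarrow> complex) \<Rightarrow> bool" where
  "bi_subexponential z \<longleftrightarrow> (\<forall>r>1. \<exists>C. \<forall>n. cmod (z n) \<le> C * r ^ nat \<bar>n\<bar>)"

lemma bi_subexponential_sum:
  assumes "\<And>i. i < (d::nat) \<Longrightarrow> bi_subexponential (z i)"
  shows "bi_subexponential (\<lambda>n. \<Sum>i<d. z i n * a i)"
  unfolding bi_subexponential_def
proof (intro allI impI)
  fix r :: real assume r: "r > 1"
  have "\<exists>C. \<forall>i<d. \<forall>n. cmod (z i n) \<le> C i * r ^ nat \<bar>n\<bar>"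
    using assms r unfolding bi_subexponential_def by (intro choice) blast
  then obtain C where C: "\<And>i n. i < d \<Longrightarrow> cmod (z i n) \<le> C i * r ^ nat \<bar>n\<bar>" by blast
  have "cmod (\<Sum>i<d. z i n * a i) \<le> (\<Sum>i<d. C i * cmod (a i)) * r ^ nat \<bar>n\<bar>" for n
  proof -
    have "cmod (\<Sum>i<d. z i n * a i) \<le> (\<Sum>i<d. cmod (z i n) * cmod (a i))"
      by (rule order_trans[OF norm_sum]) (simp add: norm_mult)
    also have "\<dots> \<le> (\<Sum>i<d. C i * r ^ nat \<bar>n\<bar> * cmod (a i))"
      using C by (intro sum_mono mult_right_mono) auto
    also have "\<dots> = (\<Sum>i<d. C i * cmod (a i)) * r ^ nat \<bar>n\<bar>"
      unfolding sum_distrib_right by (intro sum.cong) auto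
    finally show ?thesis .
  qed
  then show "\<exists>C. \<forall>n. cmod (\<Sum>i<d. z i n * a i) \<le> C * r ^ nat \<bar>n\<bar>" by blast
qed

lemma geometric_not_subexponential:
  fixes a b v :: real
  assumes "v > 1" "a > 0" and "\<And>r. r > 1 \<Longrightarrow> \<exists>C. \<forall>m::nat. v ^ m * a \<le> C * r ^ m"
  shows False
proof -
  obtain r where r: "1 < r" "r < v" using dense[OF assms(1)] by blast
  obtain C where C: "\<And>m::nat. v ^ m * a \<le> C * r ^ m" using assms(3)[OF r(1)] by blast
  have "(v / r) ^ m \<le> C / a" for m
    using C[of m] assms(2) r by (simp add: power_divide field_simps)
  moreover obtain m where "(v / r) ^ m > C / a"
    using real_arch_pow[of "v / r" "C / a"] r by auto
  ultimately show False by (simp add: leD)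
qed

text \<open>A nonzero geometric sequence grows exponentially forward if \<open>cmod u > 1\<close>
  and backward if \<open>0 < cmod u < 1\<close>. For \<open>u = 0\<close> every term is a multiple
  of 0, since the index set has no first element.\<close>

lemma bi_subexponential_geometric_eq_0:
  assumes z: "bi_subexponential z" and rec: "\<And>n. z (n + 1) = z n * u" and u: "cmod u \<noteq> 1"
  shows "z n = 0"
proof (rule ccontr)
  assume nz: "z n \<noteq> 0"
  have shift: "\<exists>C. \<forall>m::nat. cmod (z (n + s * int m)) \<le> C * r ^ m"
    if r: "r > 1" and s: "s = 1 \<or> s = - 1" for r s
  proof -
    obtain C where C: "\<And>k. cmod (z k) \<le> C * r ^ nat \<bar>k\<bar>"
      using z r unfolding bi_subexponential_def by blast
    have C0: "C \<ge> 0" using C[of 0] order_trans[OF norm_ge_zero] by fastforce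
    have "cmod (z (n + s * int m)) \<le> C * r ^ nat \<bar>n\<bar> * r ^ m" for m
    proof -
      have "cmod (z (n + s * int m)) \<le> C * r ^ nat \<bar>n + s * int m\<bar>" by (rule C)
      also have "\<dots> \<le> C * r ^ (nat \<bar>n\<bar> + m)"
        using s r C0 by (intro mult_left_mono power_increasing) auto
      finally show ?thesis by (simp add: power_add mult.assoc)
    qed
    then show ?thesis by blast
  qed
  have fwd: "z (k + int m) = z k * u ^ m" for k m
  proof (induction m)
    case (Suc m)
    then show ?case using rec[of "k + int m"] by (simp add: add_ac)
  qed simp
  consider "cmod u > 1" | "u = 0" | "u \<noteq> 0" "cmod u < 1" using u by (auto simp: not_less neq_iff)
  then show False
  proof cases
    case 1
    show False
    proof (rule geometric_not_subexponential[OF 1, of "cmod (z n)"])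
      fix r :: real assume "r > 1"
      then show "\<exists>C. \<forall>m. cmod u ^ m * cmod (z n) \<le> C * r ^ m"
        using shift[of r 1] fwd[of n] by (simp add: norm_mult norm_power mult.commute)
    qed (use nz in simp)
  next
    case 2
    then show False using rec[of "n - 1"] nz by simp
  next
    case 3
    have bwd: "z (n + (- 1) * int m) = z n / u ^ m" for m
      using fwd[of "n - int m" m] 3 by simp
    show False
    proof (rule geometric_not_subexponential[of "inverse (cmod u)" "cmod (z n)"])
      fix r :: real assume "r > 1"
      then show "\<exists>C. \<forall>m. inverse (cmod u) ^ m * cmod (z n) \<le> C * r ^ m"
        using shift[of r "- 1"] unfolding bwd
        by (simp add: norm_divide norm_mult norm_inverse norm_power divide_inverse mult.commute power_inverse)
    qed (use nz 3 in \<open>auto simp: one_less_inverse\<close>)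
  qed
qed

lemma index_mult_mat_sum:
  assumes "A \<in> carrier_mat d d" "B \<in> carrier_mat d d" "i < d" "j < d"
  shows "(A * B) $$ (i, j) = (\<Sum>k<d. A $$ (i, k) * B $$ (k, j))"
  using assms by (simp add: scalar_prod_def atLeast0LessThan)

text \<open>In the coordinates of a Schur triangularization the recursion decouples one index at a time.\<close>

lemma bi_subexponential_orbit_eq_0:
  fixes A :: "complex mat" and y :: "int \<Rightarrow> nat \<Rightarrow> complex"
  assumes A: "A \<in> carrier_mat d d" and hyp: "\<And>z. eigenvalue A z \<Longrightarrow> cmod z \<noteq> 1"
    and rec: "\<And>n k. k < d \<Longrightarrow> y (n + 1) k = (\<Sum>j<d. y n j * A $$ (j, k))"
    and sub: "\<And>j. j < d \<Longrightarrow> bi_subexponential (\<lambda>n. y n j)"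
    and j: "j < d"
  shows "y n j = 0"
proof -
  obtain es where "char_poly A = (\<Prod>a\<leftarrow>es. [:- a, 1:])"
    using char_poly_factorized[OF A] by blast
  then obtain U where "upper_triangular U" "similar_mat A U" and U: "U \<in> carrier_mat d d"
    using schur_decomposition_exists[OF A] by blast
  then obtain P Q where wit: "similar_mat_wit A U P Q" by (auto simp: similar_mat_def)
  note PQ = similar_mat_witD2[OF A wit]
  have AP: "A * P = P * U"
  proof -
    have "A * P = P * U * (Q * P)" using PQ by (simp add: assoc_mult_mat[of _ d d _ d _ d])
    then show ?thesis using PQ by simp
  qed
  have diag: "cmod (U $$ (k, k)) \<noteq> 1" if k: "k < d" for k
  proof (rule hyp)
    have "U $$ (k, k) \<in> set (diag_mat U)" using k U by (auto simp: diag_mat_def)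
    then have "poly (char_poly U) (U $$ (k, k)) = 0"
      unfolding char_poly_upper_triangular[OF U \<open>upper_triangular U\<close>]
      by (auto simp: poly_prod_list prod_list_zero_iff)
    then show "eigenvalue A (U $$ (k, k))"
      using eigenvalue_root_char_poly[OF A] char_poly_similar[OF \<open>similar_mat A U\<close>] by simp
  qed
  \<comment> \<open>The row vector \<open>z n\<close> is \<open>y n\<close> times \<open>P\<close>.
    Since \<open>A * P = P * U\<close>, its recursion has the triangular matrix \<open>U\<close> in
    place of \<open>A\<close>.\<close>
  define z where "z n k = (\<Sum>j<d. y n j * P $$ (j, k))" for n k
  have z_rec: "z (n + 1) k = (\<Sum>l<d. z n l * U $$ (l, k))" if k: "k < d" for n k
  proof -
    have "z (n + 1) k = (\<Sum>j<d. \<Sum>i<d. y n i * (A $$ (i, j) * P $$ (j, k)))"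
      by (simp add: z_def rec sum_distrib_right mult.assoc)
    also have "\<dots> = (\<Sum>i<d. y n i * (A * P) $$ (i, k))"
      using index_mult_mat_sum[OF A PQ(6)] k by (subst sum.swap) (simp add: sum_distrib_left)
    also have "\<dots> = (\<Sum>i<d. \<Sum>l<d. y n i * P $$ (i, l) * U $$ (l, k))"
      unfolding AP using index_mult_mat_sum[OF PQ(6) U] k by (simp add: sum_distrib_left mult.assoc)
    also have "\<dots> = (\<Sum>l<d. z n l * U $$ (l, k))"
      unfolding z_def by (subst sum.swap) (simp add: sum_distrib_right)
    finally show ?thesis .
  qed
  have z_0: "z n k = 0" if "k < d" for n k
    using that
  proof (induction k arbitrary: n rule: less_induct)
    case (less k)
    have "z (n + 1) k = z n k * U $$ (k, k)" for n
    proof -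
      \<comment> \<open>Terms with \<open>l < k\<close> vanish by induction, those with
        \<open>l > k\<close> by triangularity. What remains is a geometric sequence with ratio the
        eigenvalue \<open>U $$ (k, k)\<close>.\<close>
      have "z n l * U $$ (l, k) = 0" if "l \<in> {..<d} - {k}" for l
        using that less \<open>upper_triangular U\<close> U by (cases "l < k") (auto simp: upper_triangular_def)
      then have "(\<Sum>l\<in>{..<d} - {k}. z n l * U $$ (l, k)) = 0" by (intro sum.neutral) blast
      then show ?thesis
        unfolding z_rec[OF less.prems] using less.prems by (simp add: sum.remove[of _ k])
    qed
    moreover have "bi_subexponential (\<lambda>n. z n k)"
      unfolding z_def using sub by (rule bi_subexponential_sum)
    ultimately show ?case using bi_subexponential_geometric_eq_0 diag[OF less.prems] by blast
  qed
  \<comment> \<open>Multiplying by \<open>Q\<close>, the inverse of \<open>P\<close>, returns from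
    \<open>z\<close> to \<open>y\<close>.\<close>
  have "(\<Sum>k<d. z n k * Q $$ (k, j)) = (\<Sum>i<d. y n i * (P * Q) $$ (i, j))"
    unfolding z_def sum_distrib_right
    using index_mult_mat_sum[OF PQ(6,7)] j by (subst sum.swap) (simp add: sum_distrib_left mult.assoc)
  also have "\<dots> = (\<Sum>i<d. if i = j then y n j else 0)"
    using PQ(1) j by (intro sum.cong) auto
  also have "\<dots> = y n j" using j by simp
  finally show ?thesis using z_0 by simp
qed

section \<open>Subgroups of full rank\<close>

lemma common_denominator:
  fixes q :: "nat \<Rightarrow> rat"
  obtains K :: nat and m :: "nat \<Rightarrow> int" where "K > 0" "\<And>i. i < d \<Longrightarrow> of_nat K * q i = of_int (m i)"
proof -
  have "\<exists>K>0. \<forall>i<d. of_nat K * q i \<in> \<int>"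
  proof (induction d)
    case 0
    show ?case by (rule exI[of _ 1]) simp
  next
    case (Suc d)
    then obtain K where K: "K > 0" "\<And>i. i < d \<Longrightarrow> of_nat K * q i \<in> \<int>" by blast
    obtain a b :: int where ab: "b > 0" "q d = of_int a / of_int b"
      by (cases "quotient_of (q d)") (use quotient_of_denom_pos quotient_of_div in blast)
    have "of_nat (K * nat b) * q i \<in> \<int>" if "i < Suc d" for i
    proof (cases "i = d")
      case True
      have "of_nat (K * nat b) * q i = of_int (int K * a)"
        using ab True by simp
      then show ?thesis using Ints_of_int by metis
    next
      case False
      have eq: "of_nat (K * nat b) * q i = of_nat (nat b) * (of_nat K * q i)" by simp
      have "of_nat K * q i \<in> \<int>" using K(2) False that by simp
      from Ints_mult[OF Ints_of_nat this] show ?thesis unfolding eq .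
    qed
    then show ?case using K(1) ab(1) by (intro exI[of _ "K * nat b"]) simp
  qed
  then obtain K where "K > 0" "\<And>i. i < d \<Longrightarrow> of_nat K * q i \<in> \<int>" by blast
  then show ?thesis using that[of K "\<lambda>i. \<lfloor>of_nat K * q i\<rfloor>"] by (simp add: of_int_floor)
qed

locale rat_subgroup =
  fixes d :: nat and H :: "rat vec set"
  assumes subgroup_H: "subgroup H (rat_space d)"
begin

lemma H_carrier: "h \<in> H \<Longrightarrow> h \<in> carrier_vec d"
  using subgroup.subset[OF subgroup_H] by (auto simp: monoid_vec_def)

lemma H_dim: "h \<in> H \<Longrightarrow> dim_vec h = d"
  using H_carrier by auto

lemma H_zero: "0\<^sub>v d \<in> H"
  using subgroup.one_closed[OF subgroup_H] by (simp add: monoid_vec_def)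

lemma H_add: "h \<in> H \<Longrightarrow> k \<in> H \<Longrightarrow> h + k \<in> H"
  using subgroup.m_closed[OF subgroup_H] by (simp add: monoid_vec_def)

lemma inv_rat_space: "h \<in> carrier_vec d \<Longrightarrow> inv\<^bsub>rat_space d\<^esub> h = - h"
proof -
  assume h: "h \<in> carrier_vec d"
  interpret comm_group "rat_space d" by (rule comm_group_vec)
  show ?thesis using h by (intro inv_equality) (auto simp: monoid_vec_def)
qed

lemma H_uminus: "h \<in> H \<Longrightarrow> - h \<in> H"
  using subgroup.m_inv_closed[OF subgroup_H] inv_rat_space[OF H_carrier] by fastforce

lemma H_smult_nat: "h \<in> H \<Longrightarrow> of_nat m \<cdot>\<^sub>v h \<in> H"
proof (induction m)
  case 0
  then have "of_nat 0 \<cdot>\<^sub>v h = 0\<^sub>v d" using H_dim by (intro eq_vecI) auto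
  then show ?case using H_zero by simp
next
  case (Suc m)
  have "of_nat (Suc m) \<cdot>\<^sub>v h = h + of_nat m \<cdot>\<^sub>v h"
    using H_carrier Suc by (auto simp: algebra_simps)
  then show ?case using Suc H_add by simp
qed

text \<open>Deleting the coordinate \<open>k\<close> is a homomorphism into a space of dimension
  \<open>d - 1\<close>, so by minimality of the rank it is not injective on \<open>H\<close>. Two
  distinct vectors with the same image differ by a nonzero multiple of the unit vector
  \<open>k\<close>.\<close>

lemma axis_in_H_if_rank:
  assumes rank: "rat_rank ((rat_space d)\<lparr>carrier := H\<rparr>) = d" and k: "k < d"
  obtains c where "c \<noteq> 0" "c \<cdot>\<^sub>v unit_vec d k \<in> H"
proof -
  define f where "f v = vec (d - 1) (\<lambda>i. v $ (if i < k then i else Suc i))" for v :: "rat vec"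
  have "f \<in> hom ((rat_space d)\<lparr>carrier := H\<rparr>) (rat_space (d - 1))"
    using H_dim k by (intro homI) (auto simp: f_def monoid_vec_def intro!: eq_vecI)
  moreover have "f \<notin> mon ((rat_space d)\<lparr>carrier := H\<rparr>) (rat_space (d - 1))"
    using rank k not_less_Least[of "d - 1" "\<lambda>n. \<exists>f. f \<in> mon ((rat_space d)\<lparr>carrier := H\<rparr>) (rat_space n)"]
    unfolding rat_rank_def by auto
  ultimately have "\<not> inj_on f H" by (simp add: mon_def)
  then obtain v w where vw: "v \<in> H" "w \<in> H" "f v = f w" "v \<noteq> w" by (auto simp: inj_on_def)
  have eq: "v $ i = w $ i" if "i < d" "i \<noteq> k" for i
  proof -
    have "f v $ (if i < k then i else i - 1) = f w $ (if i < k then i else i - 1)" using vw by simp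
    then show ?thesis using that k by (auto simp: f_def split: if_splits)
  qed
  have "v + - w = (v $ k - w $ k) \<cdot>\<^sub>v unit_vec d k"
    using vw H_carrier[of v] H_carrier[of w] eq k by (intro eq_vecI) auto
  moreover have "v + - w \<in> H" using vw H_add H_uminus by blast
  moreover have "v $ k \<noteq> w $ k"
  proof
    assume "v $ k = w $ k"
    then have "v = w" using vw H_carrier[of v] H_carrier[of w] eq by (intro eq_vecI) auto
    then show False using vw by blast
  qed
  ultimately show ?thesis using that[of "v $ k - w $ k"] by simp
qed

end

text \<open>Full rank is used in this concrete form: \<open>H\<close> contains a rational basis
  consisting of multiples of the unit vectors. These need not generate \<open>H\<close>, which may
  fail to be finitely generated.\<close>

locale full_rank_subgroup = rat_subgroup +
  fixes c :: "nat \<Rightarrow> rat"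
  assumes c_nz: "i < d \<Longrightarrow> c i \<noteq> 0"
    and axis_in_H: "i < d \<Longrightarrow> c i \<cdot>\<^sub>v unit_vec d i \<in> H"
begin

definition b :: "nat \<Rightarrow> rat vec" where
  "b i = c i \<cdot>\<^sub>v unit_vec d i"

definition coord :: "rat vec \<Rightarrow> nat \<Rightarrow> real" where
  "coord h i = of_rat (h $ i / c i)"

lemma b_in_H: "i < d \<Longrightarrow> b i \<in> H"
  using axis_in_H by (simp add: b_def)

lemma coord_b: "i < d \<Longrightarrow> j < d \<Longrightarrow> coord (b i) j = (if i = j then 1 else 0)"
  using c_nz by (auto simp: coord_def b_def)

lemma coord_add: "h \<in> H \<Longrightarrow> k \<in> H \<Longrightarrow> i < d \<Longrightarrow> coord (h + k) i = coord h i + coord k i"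
  using H_dim by (simp add: coord_def add_divide_distrib of_rat_add)

lemma coord_uminus: "h \<in> H \<Longrightarrow> i < d \<Longrightarrow> coord (- h) i = - coord h i"
  using H_dim by (simp add: coord_def of_rat_minus)

lemma coord_smult: "h \<in> H \<Longrightarrow> i < d \<Longrightarrow> coord (of_nat K \<cdot>\<^sub>v h) i = K * coord h i"
  using H_dim by (simp add: coord_def of_rat_mult of_rat_divide)

lemma int_combination_induct:
  fixes m :: "nat \<Rightarrow> int"
  assumes zero: "P (0\<^sub>v d)" and basis: "\<And>i. i < d \<Longrightarrow> P (b i)"
    and add: "\<And>h k. h \<in> H \<Longrightarrow> k \<in> H \<Longrightarrow> P h \<Longrightarrow> P k \<Longrightarrow> P (h + k)"
    and uminus: "\<And>h. h \<in> H \<Longrightarrow> P h \<Longrightarrow> P (- h)"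
  shows "vec d (\<lambda>i. of_int (m i) * c i) \<in> H \<and> P (vec d (\<lambda>i. of_int (m i) * c i))"
proof -
  have nat: "of_nat n \<cdot>\<^sub>v b i \<in> H \<and> P (of_nat n \<cdot>\<^sub>v b i)" if i: "i < d" for i n
  proof (induction n)
    case 0
    have "of_nat 0 \<cdot>\<^sub>v b i = 0\<^sub>v d" using H_carrier[OF b_in_H[OF i]] by auto
    then show ?case using zero H_zero by simp
  next
    case (Suc n)
    have "of_nat (Suc n) \<cdot>\<^sub>v b i = b i + of_nat n \<cdot>\<^sub>v b i"
      using H_carrier[OF b_in_H[OF i]] by (auto simp: algebra_simps)
    then show ?case using Suc add basis b_in_H H_add i by simp
  qed
  have int: "of_int m \<cdot>\<^sub>v b i \<in> H \<and> P (of_int m \<cdot>\<^sub>v b i)" if i: "i < d" for i m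
  proof (cases m rule: int_cases2)
    case (nonneg n)
    then show ?thesis using nat[OF i, of n] by simp
  next
    case (nonpos n)
    have "of_int m \<cdot>\<^sub>v b i = - (of_nat n \<cdot>\<^sub>v b i)" using nonpos by auto
    then show ?thesis using nat[OF i, of n] uminus H_uminus by simp
  qed
  define g where "g n = vec d (\<lambda>i. if i < n then of_int (m i) * c i else 0)" for n
  have "g n \<in> H \<and> P (g n)" if "n \<le> d" for n
    using that
  proof (induction n)
    case 0
    have "g 0 = 0\<^sub>v d" by (auto simp: g_def)
    then show ?case using zero H_zero by simp
  next
    case (Suc n)
    have "g (Suc n) = g n + of_int (m n) \<cdot>\<^sub>v b n"
      using Suc.prems by (auto simp: g_def b_def less_Suc_eq)
    then show ?case using Suc add int[of n] H_add by simp
  qed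
  then have "g d \<in> H \<and> P (g d)" by simp
  moreover have "g d = vec d (\<lambda>i. of_int (m i) * c i)" by (auto simp: g_def)
  ultimately show ?thesis by simp
qed

text \<open>Clearing denominators of the coordinates puts a positive multiple of each element of
  \<open>H\<close> into the integer span of the \<open>b i\<close>. The case \<open>root\<close>
  descends from the multiple to the element.\<close>

lemma H_induct [consumes 1, case_names zero basis add uminus root]:
  assumes h: "h \<in> H" and zero: "P (0\<^sub>v d)" and basis: "\<And>i. i < d \<Longrightarrow> P (b i)"
    and add: "\<And>h k. h \<in> H \<Longrightarrow> k \<in> H \<Longrightarrow> P h \<Longrightarrow> P k \<Longrightarrow> P (h + k)"
    and uminus: "\<And>h. h \<in> H \<Longrightarrow> P h \<Longrightarrow> P (- h)"
    and root: "\<And>h K. h \<in> H \<Longrightarrow> K > (0::nat) \<Longrightarrow> P (of_nat K \<cdot>\<^sub>v h) \<Longrightarrow> P h"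
  shows "P h"
proof -
  obtain K :: nat and m where K: "K > 0" "\<And>i. i < d \<Longrightarrow> of_nat K * (h $ i / c i) = of_int (m i)"
    using common_denominator[of d "\<lambda>i. h $ i / c i"] by blast
  have "P (vec d (\<lambda>i. of_int (m i) * c i))"
    using int_combination_induct[OF zero basis add uminus] by blast
  also have "vec d (\<lambda>i. of_int (m i) * c i) = of_nat K \<cdot>\<^sub>v h"
    using H_carrier[OF h] K(2) c_nz by (auto simp: field_simps)
  finally show ?thesis using root[OF h K(1)] by simp
qed

lemma int_combination_in_H:
  fixes m :: "nat \<Rightarrow> int"
  obtains h where "h \<in> H" "\<And>i. i < d \<Longrightarrow> coord h i = m i"
proof (rule that)
  show "vec d (\<lambda>i. of_int (m i) * c i) \<in> H"
    using int_combination_induct[of "\<lambda>_. True"] by simp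
  show "coord (vec d (\<lambda>i. of_int (m i) * c i)) i = m i" if "i < d" for i
    using that c_nz by (simp add: coord_def)
qed

text \<open>The reals are torsion-free, so an additive map is determined by its values on the
  rational basis; in the case \<open>root\<close> one divides by \<open>K\<close>.\<close>

lemma additive_eq_coord_sum:
  fixes \<tau> :: "rat vec \<Rightarrow> real"
  assumes add: "\<And>h k. h \<in> H \<Longrightarrow> k \<in> H \<Longrightarrow> \<tau> (h + k) = \<tau> h + \<tau> k" and h: "h \<in> H"
  shows "\<tau> h = (\<Sum>i<d. coord h i * \<tau> (b i))"
proof -
  have zero: "\<tau> (0\<^sub>v d) = 0" using add[OF H_zero H_zero] by simp
  have neg: "\<tau> (- h) = - \<tau> h" if h: "h \<in> H" for h
    using add[OF H_uminus[OF h] h] H_carrier[OF h] zero by simp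
  have mult: "\<tau> (of_nat K \<cdot>\<^sub>v h) = K * \<tau> h" if h: "h \<in> H" for K h
  proof (induction K)
    case 0
    have "of_nat 0 \<cdot>\<^sub>v h = 0\<^sub>v d" using H_carrier[OF h] by auto
    then show ?case using zero by simp
  next
    case (Suc K)
    have "of_nat (Suc K) \<cdot>\<^sub>v h = h + of_nat K \<cdot>\<^sub>v h"
      using H_carrier[OF h] by (auto simp: algebra_simps)
    then show ?case using Suc add[OF h H_smult_nat[OF h]] by (simp add: algebra_simps)
  qed
  show ?thesis using h
  proof (induction rule: H_induct)
    case zero
    then show ?case using \<open>\<tau> (0\<^sub>v d) = 0\<close> by (simp add: coord_def)
  next
    case (basis i)
    have "(\<Sum>j<d. coord (b i) j * \<tau> (b j)) = (\<Sum>j<d. if j = i then \<tau> (b i) else 0)"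
      using basis by (intro sum.cong) (auto simp: coord_b)
    then show ?case using basis by simp
  next
    case (add h k)
    then show ?case using assms(1)[of h k] by (simp add: coord_add distrib_right sum.distrib)
  next
    case (uminus h)
    then show ?case using neg by (simp add: coord_uminus sum_negf)
  next
    case (root h K)
    then have "K * \<tau> h = K * (\<Sum>i<d. coord h i * \<tau> (b i))"
      using mult by (simp add: coord_smult sum_distrib_left mult.assoc)
    then show ?case using root(2) by simp
  qed
qed

end

section \<open>The action\<close>

locale affine_action = full_rank_subgroup +
  fixes A :: "rat mat" and \<phi> :: "int \<times> rat vec \<Rightarrow> real \<Rightarrow> real"
  assumes A: "A \<in> carrier (GL_rat d)"
    and A_image: "(\<lambda>v. A *\<^sub>v v) ` H = H"
    and action: "group_action (int_semidirect d A H) {0..1} \<phi>"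
    and homeo: "g \<in> carrier (int_semidirect d A H) \<Longrightarrow> orientation_preserving_homeo {0..1} (\<phi> g)"
begin

abbreviation G :: "(int \<times> rat vec) monoid" where
  "G \<equiv> int_semidirect d A H"

definition P :: "int \<Rightarrow> rat vec \<Rightarrow> rat vec" where
  "P n h = (A [^]\<^bsub>GL_rat d\<^esub> n) *\<^sub>v h"

definition act :: "rat vec \<Rightarrow> real \<Rightarrow> real" where
  "act h = \<phi> (0, h)"

text \<open>\<open>F 1\<close> is the map called \<open>f\<close> in the outline, and
  \<open>F n\<close> is its iterate, also for negative \<open>n\<close>.\<close>

definition F :: "int \<Rightarrow> real \<Rightarrow> real" where
  "F n = \<phi> (n, 0\<^sub>v d)"

lemma carrier_G: "(n, h) \<in> carrier G \<longleftrightarrow> h \<in> H"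
  by (simp add: int_semidirect_def)

lemma P_in_H: "h \<in> H \<Longrightarrow> P n h \<in> H"
  using imageI[of h H "\<lambda>v. (A [^]\<^bsub>GL_rat d\<^esub> n) *\<^sub>v v"] GL_rat_int_pow_image[OF A _ A_image, of n] H_carrier
  by (simp add: P_def subset_iff)

lemma pow_carrier: "A [^]\<^bsub>GL_rat d\<^esub> (n::int) \<in> carrier_mat d d"
proof -
  interpret group "GL_rat d" by (rule group_GL_rat)
  show ?thesis using A by (intro GL_rat_carrier) simp
qed

lemma P_add: "h \<in> H \<Longrightarrow> k \<in> H \<Longrightarrow> P n (h + k) = P n h + P n k"
  unfolding P_def by (rule mult_add_distrib_mat_vec[OF pow_carrier H_carrier H_carrier])

lemma P_P: "h \<in> H \<Longrightarrow> P m (P n h) = P (m + n) h"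
proof -
  assume h: "h \<in> H"
  interpret group "GL_rat d" by (rule group_GL_rat)
  show ?thesis
    unfolding P_def int_pow_mult[OF A] GL_rat_mult
    using assoc_mult_mat_vec[OF pow_carrier pow_carrier H_carrier[OF h]] by simp
qed

lemma P_0: "h \<in> H \<Longrightarrow> P 0 h = h"
  using H_carrier by (simp add: P_def GL_rat_one)

lemma P_1: "P 1 h = A *\<^sub>v h"
proof -
  interpret group "GL_rat d" by (rule group_GL_rat)
  show ?thesis using A by (simp add: P_def)
qed

lemma P_inverse: "h \<in> H \<Longrightarrow> P n (P (- n) h) = h"
  by (simp add: P_P P_0)

lemma \<phi>_mult:
  assumes "x \<in> {0..1}" "h \<in> H" "k \<in> H"
  shows "\<phi> (m, h) (\<phi> (n, k) x) = \<phi> (m + n, h + P m k) x"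
  using group_action.composition_rule[OF action assms(1), of "(m, h)" "(n, k)"] assms
  by (simp add: int_semidirect_def P_def)

lemma \<phi>_one: "x \<in> {0..1} \<Longrightarrow> \<phi> (0, 0\<^sub>v d) x = x"
  using fun_cong[OF group_action.id_eq_one[OF action], of x] by (simp add: int_semidirect_def)

lemma \<phi>_in:
  assumes "h \<in> H" "x \<in> {0..1}"
  shows "\<phi> (n, h) x \<in> {0..1}"
  using group_action.element_image[OF action _ assms(2), of "(n, h)"] assms carrier_G by blast

lemma \<phi>_less:
  assumes "h \<in> H" "x \<in> {0..1}" "y \<in> {0..1}" "x < y"
  shows "\<phi> (n, h) x < \<phi> (n, h) y"
  using homeo[of "(n, h)"] assms carrier_G
  unfolding orientation_preserving_homeo_def by (metis strict_mono_onD)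

lemma act_add: "h \<in> H \<Longrightarrow> k \<in> H \<Longrightarrow> x \<in> {0..1} \<Longrightarrow> act (h + k) x = act h (act k x)"
  unfolding act_def by (simp add: \<phi>_mult P_0)

lemma act_zero: "x \<in> {0..1} \<Longrightarrow> act (0\<^sub>v d) x = x"
  unfolding act_def by (rule \<phi>_one)

lemma act_in: "h \<in> H \<Longrightarrow> x \<in> {0..1} \<Longrightarrow> act h x \<in> {0..1}"
  unfolding act_def by (rule \<phi>_in)

lemma act_less_iff: "h \<in> H \<Longrightarrow> x \<in> {0..1} \<Longrightarrow> y \<in> {0..1} \<Longrightarrow> act h x < act h y \<longleftrightarrow> x < y"
  unfolding act_def using \<phi>_less[of h x y 0] \<phi>_less[of h y x 0] by (cases x y rule: linorder_cases) auto

lemma act_le_iff: "h \<in> H \<Longrightarrow> x \<in> {0..1} \<Longrightarrow> y \<in> {0..1} \<Longrightarrow> act h x \<le> act h y \<longleftrightarrow> x \<le> y"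
  using act_less_iff by (simp flip: not_less)

lemma act_uminus_act: "h \<in> H \<Longrightarrow> x \<in> {0..1} \<Longrightarrow> act (- h) (act h x) = x"
  using act_add[OF H_uminus, of h h x] H_carrier[of h] act_zero by simp

lemma act_act_uminus: "h \<in> H \<Longrightarrow> x \<in> {0..1} \<Longrightarrow> act h (act (- h) x) = x"
  using act_uminus_act[OF H_uminus, of h x] by simp

lemma act_commute: "h \<in> H \<Longrightarrow> k \<in> H \<Longrightarrow> x \<in> {0..1} \<Longrightarrow> act h (act k x) = act k (act h x)"
  using act_add[of h k x] act_add[of k h x] comm_add_vec[OF H_carrier H_carrier, of h k] by simp

lemma F_zero: "x \<in> {0..1} \<Longrightarrow> F 0 x = x"
  unfolding F_def by (rule \<phi>_one)

lemma P_zero_vec: "P n (0\<^sub>v d) = 0\<^sub>v d"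
  unfolding P_def using pow_carrier[of n] by auto

lemma F_F: "x \<in> {0..1} \<Longrightarrow> F m (F n x) = F (m + n) x"
  unfolding F_def by (simp add: \<phi>_mult H_zero P_zero_vec)

lemma F_in: "x \<in> {0..1} \<Longrightarrow> F n x \<in> {0..1}"
  unfolding F_def by (rule \<phi>_in[OF H_zero])

lemma F_less_iff: "x \<in> {0..1} \<Longrightarrow> y \<in> {0..1} \<Longrightarrow> F n x < F n y \<longleftrightarrow> x < y"
  unfolding F_def using \<phi>_less[OF H_zero, of x y n] \<phi>_less[OF H_zero, of y x n]
  by (cases x y rule: linorder_cases) auto

lemma F_le_iff: "x \<in> {0..1} \<Longrightarrow> y \<in> {0..1} \<Longrightarrow> F n x \<le> F n y \<longleftrightarrow> x \<le> y"
  using F_less_iff by (simp flip: not_less)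

text \<open>In the semidirect product, \<open>h a^n = a^n (A^(-n) h)\<close>. Hence \<open>h\<close>
  moves the translated point \<open>F n x\<close> in the way \<open>P (- n) h\<close> moves
  \<open>x\<close>; this is how the matrix enters the dynamics.\<close>

lemma act_F: "h \<in> H \<Longrightarrow> x \<in> {0..1} \<Longrightarrow> act h (F n x) = F n (act (P (- n) h) x)"
  unfolding act_def F_def
  using P_inverse[of h n] P_in_H[of h "- n"] H_carrier[of h]
  by (simp add: \<phi>_mult H_zero P_zero_vec)

lemma act_Suc_smult:
  assumes h: "h \<in> H" and x: "x \<in> {0..1}"
  shows "act (of_nat (Suc k) \<cdot>\<^sub>v h) x = act h (act (of_nat k \<cdot>\<^sub>v h) x)"
proof -
  have "of_nat (Suc k) \<cdot>\<^sub>v h = h + of_nat k \<cdot>\<^sub>v h"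
    using H_dim[OF h] by (auto simp: algebra_simps)
  then show ?thesis using act_add[OF h H_smult_nat[OF h] x] by simp
qed

lemma act_zero_smult: "h \<in> H \<Longrightarrow> x \<in> {0..1} \<Longrightarrow> act (of_nat 0 \<cdot>\<^sub>v h) x = x"
proof -
  assume h: "h \<in> H" and x: "x \<in> {0..1}"
  have "of_nat 0 \<cdot>\<^sub>v h = 0\<^sub>v d" using H_dim[OF h] by auto
  then show ?thesis using act_zero[OF x] by simp
qed

text \<open>An increasing map that moves a point up moves it further up at each iteration, and
  likewise down, so it has no periodic points other than fixed points.\<close>

lemma act_fixes_if_multiple_fixes:
  assumes h: "h \<in> H" and x: "x \<in> {0..1}" and K: "K > 0" and fixes_K: "act (of_nat K \<cdot>\<^sub>v h) x = x"
  shows "act h x = x"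
proof -
  note pow = act_Suc_smult[OF h x]
  have in_I: "act (of_nat k \<cdot>\<^sub>v h) x \<in> {0..1}" for k using act_in[OF H_smult_nat[OF h] x] .
  have up: "act (of_nat (Suc k) \<cdot>\<^sub>v h) x > x" if "act h x > x" for k
  proof (induction k)
    case 0
    show ?case unfolding pow act_zero_smult[OF h x] by (rule that)
  next
    case (Suc k)
    have "act h x < act h (act (of_nat (Suc k) \<cdot>\<^sub>v h) x)" using Suc act_less_iff[OF h x in_I[of "Suc k"]] by simp
    then show ?case using that pow[of "Suc k"] by simp
  qed
  have down: "act (of_nat (Suc k) \<cdot>\<^sub>v h) x < x" if "act h x < x" for k
  proof (induction k)
    case 0
    show ?case unfolding pow act_zero_smult[OF h x] by (rule that)
  next
    case (Suc k)
    have "act h (act (of_nat (Suc k) \<cdot>\<^sub>v h) x) < act h x" using Suc act_less_iff[OF h in_I[of "Suc k"] x] by simp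
    then show ?case using that pow[of "Suc k"] by simp
  qed
  \<comment> \<open>\<open>up\<close> and \<open>down\<close> speak of the multiple
    \<open>Suc k\<close>, so \<open>K\<close> itself corresponds to the index
    \<open>K - 1\<close>.\<close>
  show ?thesis
    using up[of "K - 1"] down[of "K - 1"] K fixes_K by (cases "act h x" x rule: linorder_cases) auto
qed

lemma H_fixes_if_basis_fixes:
  assumes x: "x \<in> {0..1}" and basis: "\<And>i. i < d \<Longrightarrow> act (b i) x = x" and h: "h \<in> H"
  shows "act h x = x"
  using h
proof (induction rule: H_induct)
  case (add h k)
  then show ?case using act_add x by simp
next
  case (uminus h)
  then show ?case using act_uminus_act[of h x] x by simp
next
  case (root h K)
  then show ?case using act_fixes_if_multiple_fixes x by blast
qed (use x act_zero basis in auto)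

end

section \<open>Consequences of C1 regularity\<close>

locale C1_affine_action = affine_action +
  assumes C1: "g \<in> carrier (int_semidirect d A H) \<Longrightarrow> C1_diffeo {0..1} (\<phi> g)"
begin

text \<open>By the mean value theorem each difference is the derivative at an intermediate point
  times \<open>Y n - X n\<close>, and continuity of the derivative makes these factors converge to
  its value at \<open>w\<close>. Both sequences may vary, and the product form also covers indices
  with \<open>X n = Y n\<close>. All later use of C1 regularity goes through this lemma.\<close>

lemma C1_slope:
  assumes g: "g \<in> carrier G" and w: "w \<in> {0..1}"
  obtains \<mu> where "\<And>X Y. (\<And>n::nat. X n \<in> {0..1}) \<Longrightarrow> (\<And>n. Y n \<in> {0..1}) \<Longrightarrow>
    X \<longlonglongrightarrow> w \<Longrightarrow> Y \<longlonglongrightarrow> w \<Longrightarrow>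
    \<exists>\<epsilon>. \<epsilon> \<longlonglongrightarrow> \<mu> \<and> (\<forall>n. \<phi> g (Y n) - \<phi> g (X n) = \<epsilon> n * (Y n - X n))"
proof -
  obtain D where D: "\<And>x. x \<in> {0..1} \<Longrightarrow> (\<phi> g has_real_derivative D x) (at x within {0..1})"
    and cont_D: "continuous_on {0..1} D"
    using C1[OF g] unfolding C1_diffeo_def C1_on_def by blast
  have cont: "continuous_on {0..1} (\<phi> g)"
    using D by (rule DERIV_continuous_on)
  have mvt_less: "\<exists>\<xi>. x \<le> \<xi> \<and> \<xi> \<le> y \<and> \<phi> g y - \<phi> g x = D \<xi> * (y - x)"
    if "x \<in> {0..1}" "y \<in> {0..1}" "x < y" for x y
  proof -
    have der: "(\<phi> g has_real_derivative D z) (at z)" if "x < z" "z < y" for z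
      using D[of z] that \<open>x \<in> {0..1}\<close> \<open>y \<in> {0..1}\<close> by (simp add: at_within_Icc_at)
    have "\<exists>l z. x < z \<and> z < y \<and> (\<phi> g has_real_derivative l) (at z) \<and> \<phi> g y - \<phi> g x = (y - x) * l"
    proof (rule MVT[OF \<open>x < y\<close>])
      show "continuous_on {x..y} (\<phi> g)" by (rule continuous_on_subset[OF cont]) (use that in auto)
      show "\<phi> g differentiable (at z)" if "x < z" "z < y" for z
        using der[OF that] real_differentiable_def by blast
    qed
    then obtain l z where lz: "x < z" "z < y" "(\<phi> g has_real_derivative l) (at z)" "\<phi> g y - \<phi> g x = (y - x) * l"
      by blast
    have "l = D z" using DERIV_unique[OF lz(3) der[OF lz(1,2)]] .
    then show ?thesis using lz by (intro exI[of _ z]) auto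
  qed
  have mvt: "\<exists>\<xi>. min x y \<le> \<xi> \<and> \<xi> \<le> max x y \<and> \<phi> g y - \<phi> g x = D \<xi> * (y - x)"
    if "x \<in> {0..1}" "y \<in> {0..1}" for x y
  proof (cases x y rule: linorder_cases)
    case less
    then show ?thesis using mvt_less that by auto
  next
    case equal
    then show ?thesis by auto
  next
    case greater
    then obtain \<xi> where "y \<le> \<xi>" "\<xi> \<le> x" "\<phi> g x - \<phi> g y = D \<xi> * (x - y)"
      using mvt_less[of y x] \<open>x \<in> {0..1}\<close> \<open>y \<in> {0..1}\<close> by blast
    then show ?thesis using greater by (intro exI[of _ \<xi>]) (auto simp: algebra_simps)
  qed
  show ?thesis
  proof (rule that)
    fix X Y :: "nat \<Rightarrow> real"
    assume XY: "\<And>n. X n \<in> {0..1}" "\<And>n. Y n \<in> {0..1}" "X \<longlonglongrightarrow> w" "Y \<longlonglongrightarrow> w"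
    have "\<exists>\<xi>. \<forall>n. min (X n) (Y n) \<le> \<xi> n \<and> \<xi> n \<le> max (X n) (Y n) \<and>
        \<phi> g (Y n) - \<phi> g (X n) = D (\<xi> n) * (Y n - X n)"
      using mvt XY by (intro choice) blast
    then obtain \<xi> where \<xi>: "\<And>n. min (X n) (Y n) \<le> \<xi> n" "\<And>n. \<xi> n \<le> max (X n) (Y n)"
      "\<And>n. \<phi> g (Y n) - \<phi> g (X n) = D (\<xi> n) * (Y n - X n)"
      by blast
    have "(\<lambda>n. min (X n) (Y n)) \<longlonglongrightarrow> min w w" using XY(3,4) by (rule tendsto_min)
    moreover have "(\<lambda>n. max (X n) (Y n)) \<longlonglongrightarrow> max w w" using XY(3,4) by (rule tendsto_max)
    ultimately have "\<xi> \<longlonglongrightarrow> w"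
      by (intro real_tendsto_sandwich[of "\<lambda>n. min (X n) (Y n)" \<xi> sequentially "\<lambda>n. max (X n) (Y n)"])
        (use \<xi> in auto)
    moreover have "\<xi> n \<in> {0..1}" for n using \<xi>(1,2)[of n] XY(1,2)[of n] by auto
    ultimately have "(\<lambda>n. D (\<xi> n)) \<longlonglongrightarrow> D w"
      using continuous_on_tendsto_compose[OF cont_D _ w, of \<xi> sequentially] by simp
    then show "\<exists>\<epsilon>. \<epsilon> \<longlonglongrightarrow> D w \<and> (\<forall>n. \<phi> g (Y n) - \<phi> g (X n) = \<epsilon> n * (Y n - X n))"
      using \<xi>(3) by blast
  qed
qed

end

section \<open>Growth along an escaping interval\<close>

text \<open>The sign \<open>s\<close> selects the direction of time, so that one argument serves
  both ends of the orbit. The element \<open>e\<close> witnesses that \<open>\<tau>\<close> is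
  nonzero.\<close>

locale escaping_interval = C1_affine_action +
  fixes s :: int and p q x0 w :: real and \<tau> :: "rat vec \<Rightarrow> real" and e :: "rat vec"
  assumes s: "s = 1 \<or> s = - 1"
    and p_in: "p \<in> {0..1}" and q_in: "q \<in> {0..1}" and w_in: "w \<in> {0..1}"
    and x0: "p < x0" "x0 < q"
    and fixes_p: "h \<in> H \<Longrightarrow> act h p = p" and fixes_q: "h \<in> H \<Longrightarrow> act h q = q"
    and lim_p: "(\<lambda>n. F (s * int n) p) \<longlonglongrightarrow> w" and lim_q: "(\<lambda>n. F (s * int n) q) \<longlonglongrightarrow> w"
    and \<tau>_add: "h \<in> H \<Longrightarrow> k \<in> H \<Longrightarrow> \<tau> (h + k) = \<tau> h + \<tau> k"
    and \<tau>_pos: "h \<in> H \<Longrightarrow> \<tau> h > 0 \<Longrightarrow> act h x0 > x0"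
    and e_in: "e \<in> H" and \<tau>_e: "\<tau> e \<noteq> 0"
begin

section \<open>Displacements along the orbit of \<open>x0\<close>\<close>

definition X :: "nat \<Rightarrow> real" where "X n = F (s * int n) x0"

text \<open>By \<open>act_F\<close>, the element \<open>h\<close> acts near \<open>X n\<close> as
  \<open>T n h\<close> acts near \<open>x0\<close>, which is where \<open>\<tau>\<close> detects
  signs.\<close>

definition T :: "nat \<Rightarrow> rat vec \<Rightarrow> rat vec" where "T n h = P (- (s * int n)) h"

definition v :: "nat \<Rightarrow> rat vec \<Rightarrow> real" where "v n h = act h (X n) - X n"

definition N :: "nat \<Rightarrow> real" where "N n = sqrt (\<Sum>j<d. (v n (b j))\<^sup>2)"

definition \<gamma> :: "nat \<Rightarrow> nat \<Rightarrow> real" where "\<gamma> n j = \<tau> (T n (b j))"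

definition M :: "nat \<Rightarrow> real" where "M n = sqrt (\<Sum>j<d. (\<gamma> n j)\<^sup>2)"

definition u :: "nat \<Rightarrow> rat vec \<Rightarrow> real" where "u n h = v n h / N n"

text \<open>The linear extension of \<open>u n\<close> from the basis. In general \<open>u n\<close>
  itself is additive only up to factors that tend to 1.\<close>

definition l :: "nat \<Rightarrow> rat vec \<Rightarrow> real" where "l n h = (\<Sum>j<d. coord h j * u n (b j))"

lemma x0_in: "x0 \<in> {0..1}" using x0 p_in q_in by auto

lemma T_in_H: "h \<in> H \<Longrightarrow> T n h \<in> H" by (simp add: T_def P_in_H)

lemma act_X: "h \<in> H \<Longrightarrow> act h (X n) = F (s * int n) (act (T n h) x0)"
  unfolding X_def T_def by (rule act_F[OF _ x0_in])

lemma act_x0_between: "h \<in> H \<Longrightarrow> p < act h x0 \<and> act h x0 < q"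
  using act_less_iff[of h p x0] act_less_iff[of h x0 q] fixes_p fixes_q x0 x0_in p_in q_in by metis

lemma act_X_between:
  assumes "h \<in> H"
  shows "F (s * int n) p < act h (X n)" "act h (X n) < F (s * int n) q"
  using act_x0_between[OF T_in_H[OF assms]] F_less_iff act_in[OF T_in_H[OF assms] x0_in] p_in q_in
  unfolding act_X[OF assms] by auto

lemma X_in: "X n \<in> {0..1}" unfolding X_def by (rule F_in[OF x0_in])

lemma lim_act_X: "h \<in> H \<Longrightarrow> (\<lambda>n. act h (X n)) \<longlonglongrightarrow> w"
  using act_X_between
  by (intro real_tendsto_sandwich[OF _ _ lim_p lim_q] always_eventually allI less_imp_le)

lemma lim_X: "X \<longlonglongrightarrow> w"
  using lim_act_X[OF H_zero] act_zero[OF X_in] by simp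

text \<open>
  An element of \<open>H\<close> fixes both ends of the intervals that shrink to \<open>w\<close>, so its derivative at
  \<open>w\<close> is 1.
\<close>

lemma slope_act:
  assumes h: "h \<in> H" and k: "k \<in> H"
  obtains \<epsilon> where "\<epsilon> \<longlonglongrightarrow> 1" "\<And>n. act h (act k (X n)) - act h (X n) = \<epsilon> n * v n k"
proof -
  obtain \<mu> where \<mu>: "\<And>X Y. (\<And>n::nat. X n \<in> {0..1}) \<Longrightarrow> (\<And>n. Y n \<in> {0..1}) \<Longrightarrow>
    X \<longlonglongrightarrow> w \<Longrightarrow> Y \<longlonglongrightarrow> w \<Longrightarrow>
    \<exists>\<epsilon>. \<epsilon> \<longlonglongrightarrow> \<mu> \<and> (\<forall>n. act h (Y n) - act h (X n) = \<epsilon> n * (Y n - X n))"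
    using C1_slope[OF _ w_in, of "(0, h)"] h carrier_G unfolding act_def by metis
  have fix_F: "act h (F m y) = F m y" if "y = p \<or> y = q" for m y
    using act_F[OF h, of y m] fixes_p fixes_q P_in_H[OF h] p_in q_in that by auto
  obtain \<epsilon> where \<epsilon>: "\<epsilon> \<longlonglongrightarrow> \<mu>" "\<And>n. act h (F (s * int n) q) - act h (F (s * int n) p)
      = \<epsilon> n * (F (s * int n) q - F (s * int n) p)"
    using \<mu>[of "\<lambda>n. F (s * int n) p" "\<lambda>n. F (s * int n) q"] F_in p_in q_in lim_p lim_q by blast
  have "\<epsilon> n = 1" for n
  proof -
    have "F (s * int n) p < F (s * int n) q" using F_less_iff p_in q_in x0 by simp
    then show ?thesis using \<epsilon>(2)[of n] fix_F by simp
  qed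
  then have "\<epsilon> = (\<lambda>n. 1)" by auto
  then have "\<mu> = 1" using \<epsilon>(1) by (simp add: LIMSEQ_const_iff)
  then show ?thesis
    using \<mu>[of X "\<lambda>n. act k (X n)"] X_in act_in[OF k X_in] lim_X lim_act_X[OF k] that
    unfolding v_def by blast
qed

lemma v_add:
  assumes h: "h \<in> H" and k: "k \<in> H"
  obtains \<epsilon> where "\<epsilon> \<longlonglongrightarrow> 1" "\<And>n. v n (h + k) = v n h + \<epsilon> n * v n k"
proof -
  obtain \<epsilon> where "\<epsilon> \<longlonglongrightarrow> 1" "\<And>n. act h (act k (X n)) - act h (X n) = \<epsilon> n * v n k"
    using slope_act[OF h k] by blast
  then show ?thesis using that[of \<epsilon>] act_add[OF h k X_in] by (simp add: v_def algebra_simps)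
qed

lemma \<tau>_T: "h \<in> H \<Longrightarrow> \<tau> (T n h) = (\<Sum>j<d. coord h j * \<gamma> n j)"
  unfolding \<gamma>_def by (rule additive_eq_coord_sum) (simp_all add: T_def P_add P_in_H \<tau>_add)

lemma T_P: "h \<in> H \<Longrightarrow> T n (P (s * int n) h) = h"
  by (simp add: T_def P_P P_0)

lemma v_pos: "h \<in> H \<Longrightarrow> \<tau> (T n h) > 0 \<Longrightarrow> v n h > 0"
  using \<tau>_pos[OF T_in_H] F_less_iff[OF x0_in act_in[OF T_in_H x0_in]]
  by (simp add: v_def act_X) (simp add: X_def)

lemma v_nonzero: "h \<in> H \<Longrightarrow> \<tau> (T n h) \<noteq> 0 \<Longrightarrow> v n h \<noteq> 0"
proof
  assume h: "h \<in> H" and \<tau>: "\<tau> (T n h) \<noteq> 0" and "v n h = 0"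
  then have fx: "act h (X n) = X n" by (simp add: v_def)
  have "\<tau> (T n (- h)) = - \<tau> (T n h)"
    using h by (simp add: \<tau>_T H_uminus coord_uminus sum_negf)
  then have "\<tau> (T n (- h)) > 0 \<or> \<tau> (T n h) > 0" using \<tau> by linarith
  moreover have "v n (- h) = 0" using act_uminus_act[OF h X_in, of n] fx by (simp add: v_def)
  ultimately show False using v_pos[OF h] v_pos[OF H_uminus[OF h]] \<open>v n h = 0\<close> by fastforce
qed

text \<open>\<open>T n\<close> maps \<open>H\<close> onto \<open>H\<close>, so \<open>\<tau>\<close>
  composed with \<open>T n\<close> cannot vanish on the whole basis without forcing
  \<open>\<tau> e = 0\<close>.\<close>

lemma \<gamma>_nonzero: obtains j where "j < d" "\<gamma> n j \<noteq> 0"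
proof -
  have "\<tau> e = (\<Sum>j<d. coord (P (s * int n) e) j * \<gamma> n j)"
    using \<tau>_T[of "P (s * int n) e" n] P_in_H[OF e_in] T_P[OF e_in] by simp
  then have "\<exists>j<d. \<gamma> n j \<noteq> 0" using \<tau>_e by (metis (no_types, lifting) lessThan_iff mult_zero_right sum.neutral)
  then show ?thesis using that by blast
qed

lemma M_pos: "M n > 0"
proof -
  obtain j where "j < d" "\<gamma> n j \<noteq> 0" by (rule \<gamma>_nonzero)
  then have "(\<Sum>j<d. (\<gamma> n j)\<^sup>2) > 0" by (intro sum_pos2[of _ j]) auto
  then show ?thesis by (simp add: M_def)
qed

lemma N_pos: "N n > 0"
proof -
  obtain j where j: "j < d" "\<gamma> n j \<noteq> 0" by (rule \<gamma>_nonzero)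
  then have "v n (b j) \<noteq> 0" using v_nonzero[OF b_in_H] by (simp add: \<gamma>_def)
  then have "(\<Sum>j<d. (v n (b j))\<^sup>2) > 0" using j by (intro sum_pos2[of _ j]) auto
  then show ?thesis by (simp add: N_def)
qed

lemma sum_u_sq: "(\<Sum>j<d. (u n (b j))\<^sup>2) = 1"
proof -
  have "(N n)\<^sup>2 = (\<Sum>j<d. (v n (b j))\<^sup>2)" by (simp add: N_def sum_nonneg)
  then show ?thesis using N_pos[of n] by (simp add: u_def power_divide flip: sum_divide_distrib \<open>(N n)\<^sup>2 = _\<close>)
qed

lemma sum_\<gamma>_sq: "(\<Sum>j<d. (\<gamma> n j / M n)\<^sup>2) = 1"
proof -
  have "(M n)\<^sup>2 = (\<Sum>j<d. (\<gamma> n j)\<^sup>2)" by (simp add: M_def sum_nonneg)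
  then show ?thesis using M_pos[of n] by (simp add: power_divide flip: sum_divide_distrib \<open>(M n)\<^sup>2 = _\<close>)
qed

lemma Bseq_l: "Bseq (\<lambda>n. l n h)"
proof (rule BseqI')
  fix n
  have "\<bar>l n h\<bar> \<le> (\<Sum>j<d. \<bar>coord h j\<bar> * \<bar>u n (b j)\<bar>)"
    unfolding l_def by (rule order_trans[OF sum_abs]) (simp add: abs_mult)
  also have "\<dots> \<le> (\<Sum>j<d. \<bar>coord h j\<bar> * 1)"
    using abs_le_1_if_sum_sq[OF sum_u_sq] by (intro sum_mono mult_left_mono) auto
  finally show "norm (l n h) \<le> (\<Sum>j<d. \<bar>coord h j\<bar>)" by simp
qed

lemma u_add:
  assumes h: "h \<in> H" and k: "k \<in> H"
  obtains \<epsilon> where "\<epsilon> \<longlonglongrightarrow> 1" "\<And>n. u n (h + k) = u n h + \<epsilon> n * u n k"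
  using v_add[OF h k] by (metis (no_types, lifting) u_def add_divide_distrib times_divide_eq_right)

lemma l_add: "h \<in> H \<Longrightarrow> k \<in> H \<Longrightarrow> l n (h + k) = l n h + l n k"
  unfolding l_def by (simp add: coord_add distrib_right sum.distrib)

lemma l_uminus: "h \<in> H \<Longrightarrow> l n (- h) = - l n h"
  unfolding l_def by (simp add: coord_uminus sum_negf)

lemma l_smult: "h \<in> H \<Longrightarrow> l n (of_nat K \<cdot>\<^sub>v h) = K * l n h"
  unfolding l_def by (simp add: coord_smult sum_distrib_left mult.assoc)

lemma u_zero: "u n (0\<^sub>v d) = 0"
  using act_zero[OF X_in] by (simp add: u_def v_def)

lemma u_smult:
  assumes h: "h \<in> H"
  obtains \<kappa> where "\<kappa> \<longlonglongrightarrow> real K" "\<And>n. u n (of_nat K \<cdot>\<^sub>v h) = \<kappa> n * u n h"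
proof -
  have "\<exists>\<kappa>. \<kappa> \<longlonglongrightarrow> real K \<and> (\<forall>n. u n (of_nat K \<cdot>\<^sub>v h) = \<kappa> n * u n h)"
  proof (induction K)
    case 0
    have "of_nat 0 \<cdot>\<^sub>v h = 0\<^sub>v d" using H_dim[OF h] by (intro eq_vecI) auto
    then show ?case using u_zero by (intro exI[of _ "\<lambda>n. 0"]) simp
  next
    case (Suc K)
    then obtain \<kappa> where \<kappa>: "\<kappa> \<longlonglongrightarrow> real K" "\<And>n. u n (of_nat K \<cdot>\<^sub>v h) = \<kappa> n * u n h" by blast
    obtain \<epsilon> where \<epsilon>: "\<epsilon> \<longlonglongrightarrow> 1" "\<And>n. u n (h + of_nat K \<cdot>\<^sub>v h) = u n h + \<epsilon> n * u n (of_nat K \<cdot>\<^sub>v h)"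
      using u_add[OF h H_smult_nat[OF h]] by blast
    have "of_nat (Suc K) \<cdot>\<^sub>v h = h + of_nat K \<cdot>\<^sub>v h"
      using H_dim[OF h] by (auto simp: algebra_simps)
    moreover have "(\<lambda>n. 1 + \<epsilon> n * \<kappa> n) \<longlonglongrightarrow> 1 + 1 * real K"
      by (intro tendsto_intros \<epsilon> \<kappa>)
    ultimately show ?case using \<epsilon>(2) \<kappa>(2)
      by (intro exI[of _ "\<lambda>n. 1 + \<epsilon> n * \<kappa> n"]) (simp add: algebra_simps)
  qed
  then show ?thesis using that by blast
qed

text \<open>Sums, negatives and multiples are respected up to factors with the expected limits. The
  resulting errors vanish because \<open>l n h\<close> is bounded in \<open>n\<close>, and with it
  \<open>u n h\<close> by the induction hypothesis.\<close>

lemma u_approx_linear: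
  assumes "h \<in> H"
  shows "(\<lambda>n. u n h - l n h) \<longlonglongrightarrow> 0"
  using assms
proof (induction rule: H_induct)
  case zero
  have "l n (0\<^sub>v d) = 0" for n by (simp add: l_def coord_def)
  then show ?case using u_zero by simp
next
  case (basis i)
  have "l n (b i) = (\<Sum>j<d. if j = i then u n (b i) else 0)" for n
    unfolding l_def using basis by (intro sum.cong) (auto simp: coord_b)
  then show ?case using basis by simp
next
  case (add h k)
  obtain \<epsilon> where \<epsilon>: "\<epsilon> \<longlonglongrightarrow> 1" "\<And>n. u n (h + k) = u n h + \<epsilon> n * u n k"
    using u_add[OF add(1,2)] by blast
  have "(\<lambda>n. \<epsilon> n - 1) \<longlonglongrightarrow> 0" using tendsto_diff[OF \<epsilon>(1) tendsto_const, of 1] by simp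
  then have "(\<lambda>n. (\<epsilon> n - 1) * u n k) \<longlonglongrightarrow> 0"
    using Bseq_if_diff_tendsto[OF add(4) Bseq_l] by (rule tendsto_Bseq_mult_zero)
  from tendsto_add[OF tendsto_add[OF add(3,4)] this]
  show ?case by (simp add: \<epsilon>(2) l_add[OF add(1,2)] algebra_simps)
next
  case (uminus h)
  obtain \<epsilon> where \<epsilon>: "\<epsilon> \<longlonglongrightarrow> 1" "\<And>n. u n (- h + h) = u n (- h) + \<epsilon> n * u n h"
    using u_add[OF H_uminus[OF uminus(1)] uminus(1)] by blast
  have "- h + h = 0\<^sub>v d" using H_carrier[OF uminus(1)] by simp
  then have eq: "u n (- h) = - \<epsilon> n * u n h" for n using \<epsilon>(2)[of n] u_zero by simp
  have "(\<lambda>n. 1 - \<epsilon> n) \<longlonglongrightarrow> 0" using tendsto_diff[OF tendsto_const \<epsilon>(1), of 1] by simp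
  then have "(\<lambda>n. (1 - \<epsilon> n) * u n h) \<longlonglongrightarrow> 0"
    using Bseq_if_diff_tendsto[OF uminus(2) Bseq_l] by (rule tendsto_Bseq_mult_zero)
  from tendsto_diff[OF this uminus(2)]
  show ?case by (simp add: eq l_uminus[OF uminus(1)] algebra_simps)
next
  case (root h K)
  obtain \<kappa> where \<kappa>: "\<kappa> \<longlonglongrightarrow> real K" "\<And>n. u n (of_nat K \<cdot>\<^sub>v h) = \<kappa> n * u n h"
    using u_smult[OF root(1)] by blast
  have "(\<lambda>n. real K - \<kappa> n) \<longlonglongrightarrow> 0" using tendsto_diff[OF tendsto_const \<kappa>(1), of "real K"] by simp
  \<comment> \<open>The identity behind this is \<open>\<kappa> (u h - l h) = (u (K h) - K l h) + (K
    - \<kappa>) l h\<close>. The limit \<open>K\<close> of \<open>\<kappa>\<close> is not 0, so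
    \<open>\<kappa>\<close> can be divided out.\<close>
  then have "(\<lambda>n. (real K - \<kappa> n) * l n h) \<longlonglongrightarrow> 0" using Bseq_l by (rule tendsto_Bseq_mult_zero)
  from tendsto_add[OF root(3) this]
  have "(\<lambda>n. \<kappa> n * (u n h - l n h)) \<longlonglongrightarrow> 0"
    by (simp add: \<kappa>(2) l_smult[OF root(1)] algebra_simps)
  then have lim: "(\<lambda>n. \<kappa> n * (u n h - l n h) / \<kappa> n) \<longlonglongrightarrow> 0 / real K"
    using \<kappa>(1) root(2) by (intro tendsto_divide) auto
  have "\<forall>\<^sub>F n in sequentially. \<kappa> n > 0"
    using order_tendstoD(1)[OF \<kappa>(1), of 0] root(2) by simp
  then have "\<forall>\<^sub>F n in sequentially. \<kappa> n * (u n h - l n h) / \<kappa> n = u n h - l n h"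
    by (rule eventually_mono) simp
  from Lim_transform_eventually[OF lim this] show ?case by simp
qed

text \<open>Wherever \<open>\<tau> (T n h) > 0\<close>, the displacement of \<open>h\<close> is
  positive. Up to the error \<open>l n h - u n h\<close>, this is the half-space condition between
  the two sequences of unit vectors.\<close>

lemma u_minus_\<gamma>_tendsto_0:
  assumes j: "j < d"
  shows "(\<lambda>n. u n (b j) - \<gamma> n j / M n) \<longlonglongrightarrow> 0"
  using _ _ _ j
proof (rule unit_vectors_diff_tendsto_0)
  fix m :: "nat \<Rightarrow> int"
  obtain h where h: "h \<in> H" "\<And>i. i < d \<Longrightarrow> coord h i = m i" using int_combination_in_H by blast
  have l_eq: "l n h = (\<Sum>j<d. m j * u n (b j))" for n by (simp add: l_def h)
  have "(\<Sum>j<d. m j * u n (b j)) \<ge> l n h - u n h" if pos: "(\<Sum>j<d. m j * (\<gamma> n j / M n)) > 0" for n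
  proof -
    have "(\<Sum>j<d. m j * (\<gamma> n j / M n)) = \<tau> (T n h) / M n"
      by (simp add: \<tau>_T h sum_divide_distrib)
    then have "\<tau> (T n h) > 0" using pos M_pos[of n] by (simp add: zero_less_divide_iff)
    then have "u n h > 0" using v_pos[OF h(1)] N_pos by (simp add: u_def)
    then show ?thesis using l_eq by simp
  qed
  moreover have "(\<lambda>n. l n h - u n h) \<longlonglongrightarrow> 0"
    using tendsto_minus[OF u_approx_linear[OF h(1)]] by simp
  ultimately show "\<exists>E. E \<longlonglongrightarrow> 0 \<and> (\<forall>n. 0 < (\<Sum>j<d. m j * (\<gamma> n j / M n)) \<longrightarrow> E n \<le> (\<Sum>j<d. m j * u n (b j)))"
    by (intro exI[of _ "\<lambda>n. l n h - u n h"]) simp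
qed (simp_all only: sum_u_sq sum_\<gamma>_sq)

section \<open>Growth factors given by the derivative at \<open>w\<close>\<close>

definition len :: "nat \<Rightarrow> real" where "len n = F (s * int n) q - F (s * int n) p"

lemma len_pos: "len n > 0"
  using F_less_iff[OF p_in q_in] x0 by (simp add: len_def)

lemma F_Suc: "y \<in> {0..1} \<Longrightarrow> F (s * int (Suc n)) y = F s (F (s * int n) y)"
  by (simp add: F_F algebra_simps)

lemma T_Suc: "h \<in> H \<Longrightarrow> T (Suc n) h = T n (P (- s) h)"
  by (simp add: T_def P_P algebra_simps)

lemma v_Suc: "h \<in> H \<Longrightarrow> v (Suc n) h = F s (act (P (- s) h) (X n)) - F s (X n)"
  unfolding v_def X_def using act_F[of h "F (s * int n) x0" s] F_in[OF x0_in]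
  by (simp only: F_Suc[OF x0_in])

text \<open>The same slope \<open>\<mu>\<close> of \<open>F s\<close> at \<open>w\<close> governs
  displacements and interval lengths. It is positive: the ratios of lengths are positive, and the
  slope of \<open>F (- s)\<close> is its inverse.\<close>

lemma slope_F:
  obtains \<mu> where "\<mu> > 0"
    and "\<And>h. h \<in> H \<Longrightarrow> \<exists>\<epsilon>. \<epsilon> \<longlonglongrightarrow> \<mu> \<and> (\<forall>n. v (Suc n) h = \<epsilon> n * v n (P (- s) h))"
    and "(\<lambda>n. len (Suc n) / len n) \<longlonglongrightarrow> \<mu>"
proof -
  have in_G: "(m, 0\<^sub>v d) \<in> carrier G" for m using carrier_G H_zero by blast
  obtain \<mu> where \<mu>: "\<And>X Y. (\<And>n::nat. X n \<in> {0..1}) \<Longrightarrow> (\<And>n. Y n \<in> {0..1}) \<Longrightarrow>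
    X \<longlonglongrightarrow> w \<Longrightarrow> Y \<longlonglongrightarrow> w \<Longrightarrow>
    \<exists>\<epsilon>. \<epsilon> \<longlonglongrightarrow> \<mu> \<and> (\<forall>n. F s (Y n) - F s (X n) = \<epsilon> n * (Y n - X n))"
    using C1_slope[OF in_G[of s] w_in] unfolding F_def by metis
  obtain \<mu>' where \<mu>': "\<And>X Y. (\<And>n::nat. X n \<in> {0..1}) \<Longrightarrow> (\<And>n. Y n \<in> {0..1}) \<Longrightarrow>
    X \<longlonglongrightarrow> w \<Longrightarrow> Y \<longlonglongrightarrow> w \<Longrightarrow>
    \<exists>\<epsilon>. \<epsilon> \<longlonglongrightarrow> \<mu>' \<and> (\<forall>n. F (- s) (Y n) - F (- s) (X n) = \<epsilon> n * (Y n - X n))"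
    using C1_slope[OF in_G[of "- s"] w_in] unfolding F_def by metis
  obtain \<theta> where \<theta>: "\<theta> \<longlonglongrightarrow> \<mu>" "\<And>n. len (Suc n) = \<theta> n * len n"
    using \<mu>[of "\<lambda>n. F (s * int n) p" "\<lambda>n. F (s * int n) q"] F_in p_in q_in lim_p lim_q
    unfolding len_def F_Suc[OF p_in] F_Suc[OF q_in] by blast
  have back_F: "F (- s) (F (s * int (Suc n)) y) = F (s * int n) y" if "y \<in> {0..1}" for n y
    using that by (simp add: F_F algebra_simps)
  have "\<exists>\<theta>'. \<theta>' \<longlonglongrightarrow> \<mu>' \<and> (\<forall>n. F (- s) (F (s * int (Suc n)) q) - F (- s) (F (s * int (Suc n)) p)
      = \<theta>' n * (F (s * int (Suc n)) q - F (s * int (Suc n)) p))"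
    using F_in p_in q_in LIMSEQ_Suc[OF lim_p] LIMSEQ_Suc[OF lim_q] by (intro \<mu>') auto
  then obtain \<theta>' where \<theta>': "\<theta>' \<longlonglongrightarrow> \<mu>'" "\<And>n. len n = \<theta>' n * len (Suc n)"
    unfolding len_def back_F[OF p_in] back_F[OF q_in] by blast
  have theta_inv: "\<theta> n * \<theta>' n = 1" for n
  proof -
    have "\<theta> n * \<theta>' n * len n = \<theta>' n * len (Suc n)" using \<theta>(2)[of n] by simp
    also have "\<dots> = 1 * len n" using \<theta>'(2)[of n] by simp
    finally show ?thesis using len_pos[of n] by simp
  qed
  have "(\<lambda>n. \<theta> n * \<theta>' n) \<longlonglongrightarrow> \<mu> * \<mu>'" using \<theta>(1) \<theta>'(1) by (rule tendsto_mult)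
  then have "\<mu> * \<mu>' = 1" by (simp add: theta_inv LIMSEQ_const_iff)
  moreover have \<theta>_pos: "\<theta> n > 0" for n
    using \<theta>(2)[of n] len_pos[of n] len_pos[of "Suc n"] by (simp add: zero_less_mult_iff)
  then have "\<mu> \<ge> 0" using \<theta>(1) by (intro LIMSEQ_le_const) (auto intro: less_imp_le)
  ultimately have "\<mu> > 0" by (cases "\<mu> = 0") auto
  moreover have "\<exists>\<epsilon>. \<epsilon> \<longlonglongrightarrow> \<mu> \<and> (\<forall>n. v (Suc n) h = \<epsilon> n * v n (P (- s) h))" if h: "h \<in> H" for h
  proof -
    have k: "P (- s) h \<in> H" using h by (rule P_in_H)
    have "\<exists>\<epsilon>. \<epsilon> \<longlonglongrightarrow> \<mu> \<and> (\<forall>n. F s (act (P (- s) h) (X n)) - F s (X n) = \<epsilon> n * (act (P (- s) h) (X n) - X n))"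
      using X_in act_in[OF k X_in] lim_X lim_act_X[OF k] by (intro \<mu>) auto
    then show ?thesis unfolding v_Suc[OF h] by (simp add: v_def)
  qed
  moreover have "(\<lambda>n. len (Suc n) / len n) = \<theta>"
    using \<theta>(2) len_pos by (intro ext) (simp add: less_imp_neq[symmetric])
  then have "(\<lambda>n. len (Suc n) / len n) \<longlonglongrightarrow> \<mu>" using \<theta>(1) by simp
  ultimately show ?thesis by (rule that)
qed

lemma N_sq: "(N n)\<^sup>2 = (\<Sum>j<d. (v n (b j))\<^sup>2)"
  by (simp add: N_def sum_nonneg)

lemma M_sq: "(M n)\<^sup>2 = (\<Sum>j<d. (\<gamma> n j)\<^sup>2)"
  by (simp add: M_def sum_nonneg)

lemma abs_\<gamma>_le_M: "j < d \<Longrightarrow> \<bar>\<gamma> n j\<bar> \<le> M n"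
  using abs_le_1_if_sum_sq[OF sum_\<gamma>_sq, of j n] M_pos[of n] by (simp add: abs_divide)

lemma \<gamma>_Suc: "j < d \<Longrightarrow> \<gamma> (Suc n) j = (\<Sum>i<d. coord (P (- s) (b j)) i * \<gamma> n i)"
  using \<tau>_T[OF P_in_H[OF b_in_H]] T_Suc[OF b_in_H] by (simp add: \<gamma>_def)

lemma \<gamma>_Suc_inverse: "j < d \<Longrightarrow> \<gamma> n j = (\<Sum>i<d. coord (P s (b j)) i * \<gamma> (Suc n) i)"
  using \<tau>_T[OF P_in_H[OF b_in_H, of j s], of "Suc n"] T_Suc[OF P_in_H[OF b_in_H, of j s]]
    P_inverse[OF b_in_H, of j "- s"]
  by (simp add: \<gamma>_def)

text \<open>Both sequences follow the same linear recursion, up to the factor given by the derivative at \<open>w\<close>.\<close>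

lemma v_Suc_approx:
  assumes \<mu>: "\<And>h. h \<in> H \<Longrightarrow> \<exists>\<epsilon>. \<epsilon> \<longlonglongrightarrow> \<mu> \<and> (\<forall>n. v (Suc n) h = \<epsilon> n * v n (P (- s) h))"
    and j: "j < d"
  shows "(\<lambda>n. v (Suc n) (b j) / N n - \<mu> * (\<gamma> (Suc n) j / M n)) \<longlonglongrightarrow> 0"
    and "Bseq (\<lambda>n. \<gamma> (Suc n) j / M n)"
proof -
  let ?k = "P (- s) (b j)"
  have k: "?k \<in> H" using b_in_H[OF j] by (rule P_in_H)
  have "(\<lambda>n. \<Sum>i<d. coord ?k i * (u n (b i) - \<gamma> n i / M n)) \<longlonglongrightarrow> (\<Sum>i<d. coord ?k i * 0)"
    by (intro tendsto_sum tendsto_mult tendsto_const u_minus_\<gamma>_tendsto_0) simp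
  moreover have "(\<Sum>i<d. coord ?k i * (u n (b i) - \<gamma> n i / M n)) = l n ?k - \<gamma> (Suc n) j / M n" for n
    by (simp add: l_def \<gamma>_Suc[OF j] sum_divide_distrib right_diff_distrib sum_subtractf)
  ultimately have lim1: "(\<lambda>n. l n ?k - \<gamma> (Suc n) j / M n) \<longlonglongrightarrow> 0" by simp
  show B: "Bseq (\<lambda>n. \<gamma> (Suc n) j / M n)"
    by (rule Bseq_if_diff_tendsto[OF _ Bseq_l[of ?k]]) (use tendsto_minus[OF lim1] in simp)
  obtain \<epsilon> where \<epsilon>: "\<epsilon> \<longlonglongrightarrow> \<mu>" "\<And>n. v (Suc n) (b j) = \<epsilon> n * v n ?k"
    using \<mu>[OF b_in_H[OF j]] by blast
  have lim2: "(\<lambda>n. u n ?k - \<gamma> (Suc n) j / M n) \<longlonglongrightarrow> 0"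
    using tendsto_add[OF u_approx_linear[OF k] lim1] by simp
  have "(\<lambda>n. \<epsilon> n - \<mu>) \<longlonglongrightarrow> 0" using tendsto_diff[OF \<epsilon>(1) tendsto_const, of \<mu>] by simp
  then have "(\<lambda>n. (\<epsilon> n - \<mu>) * u n ?k) \<longlonglongrightarrow> 0"
    using Bseq_if_diff_tendsto[OF lim2 B] by (rule tendsto_Bseq_mult_zero)
  from tendsto_add[OF this tendsto_mult[OF tendsto_const lim2, of \<mu>]]
  have "(\<lambda>n. \<epsilon> n * u n ?k - \<mu> * (\<gamma> (Suc n) j / M n)) \<longlonglongrightarrow> 0"
    by (simp only: left_diff_distrib right_diff_distrib) simp
  then
  show "(\<lambda>n. v (Suc n) (b j) / N n - \<mu> * (\<gamma> (Suc n) j / M n)) \<longlonglongrightarrow> 0"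
    by (simp add: \<epsilon>(2) u_def)
qed

text \<open>A matrix independent of \<open>n\<close> recovers \<open>\<gamma> n\<close> from
  \<open>\<gamma> (Suc n)\<close>, so \<open>M\<close> can shrink only by a bounded factor in one
  step. The bound \<open>K\<close> is the sum of the squared absolute row sums of that
  matrix.\<close>

lemma M_ratio_lower:
  obtains K where "\<And>n. 1 \<le> K * (M (Suc n) / M n)\<^sup>2"
proof
  fix n
  define C where "C i = (\<Sum>j<d. \<bar>coord (P s (b i)) j\<bar>)" for i
  have "(\<gamma> n i / M n)\<^sup>2 \<le> (C i)\<^sup>2 * (M (Suc n) / M n)\<^sup>2" if i: "i < d" for i
  proof -
    have "\<bar>\<gamma> n i\<bar> \<le> (\<Sum>j<d. \<bar>coord (P s (b i)) j\<bar> * \<bar>\<gamma> (Suc n) j\<bar>)"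
      unfolding \<gamma>_Suc_inverse[OF i] by (rule order_trans[OF sum_abs]) (simp add: abs_mult)
    also have "\<dots> \<le> C i * M (Suc n)"
      unfolding C_def sum_distrib_right using abs_\<gamma>_le_M by (intro sum_mono mult_left_mono) auto
    finally have "\<bar>\<gamma> n i\<bar> / M n \<le> C i * M (Suc n) / M n" using M_pos[of n] by (simp add: divide_right_mono)
    then have "\<bar>\<gamma> n i / M n\<bar> \<le> C i * (M (Suc n) / M n)" using M_pos[of n] by simp
    then have "\<bar>\<gamma> n i / M n\<bar>\<^sup>2 \<le> (C i * (M (Suc n) / M n))\<^sup>2" by (rule power_mono) simp
    then show ?thesis by (simp only: power2_abs power_mult_distrib)
  qed
  then have "(\<Sum>i<d. (\<gamma> n i / M n)\<^sup>2) \<le> (\<Sum>i<d. (C i)\<^sup>2 * (M (Suc n) / M n)\<^sup>2)"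
    by (intro sum_mono) simp
  then show "1 \<le> (\<Sum>i<d. (\<Sum>j<d. \<bar>coord (P s (b i)) j\<bar>)\<^sup>2) * (M (Suc n) / M n)\<^sup>2"
    unfolding sum_\<gamma>_sq by (simp add: C_def sum_distrib_right)
qed

text \<open>The vectors \<open>a n\<close> and \<open>\<mu> * c n\<close> are asymptotically equal,
  and the norms of \<open>a n\<close> and \<open>c n\<close> are \<open>\<rho> n\<close> and
  \<open>\<sigma> n\<close>. Since \<open>\<sigma> n\<close> is bounded away from 0, the quotient of
  the norms converges as well.\<close>

lemma norm_ratio_tendsto:
  assumes \<mu>_pos: "\<mu> > 0"
    and \<mu>: "\<And>h. h \<in> H \<Longrightarrow> \<exists>\<epsilon>. \<epsilon> \<longlonglongrightarrow> \<mu> \<and> (\<forall>n. v (Suc n) h = \<epsilon> n * v n (P (- s) h))"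
  shows "(\<lambda>n. (N (Suc n) / N n) / (M (Suc n) / M n)) \<longlonglongrightarrow> \<mu>"
proof -
  define a where "a n j = v (Suc n) (b j) / N n" for n j
  define c where "c n j = \<gamma> (Suc n) j / M n" for n j
  define \<rho> where "\<rho> n = N (Suc n) / N n" for n
  define \<sigma> where "\<sigma> n = M (Suc n) / M n" for n
  have pos: "\<rho> n > 0" "\<sigma> n > 0" for n
    using N_pos[of n] N_pos[of "Suc n"] M_pos[of n] M_pos[of "Suc n"] by (simp_all add: \<rho>_def \<sigma>_def)
  have ac: "(\<lambda>n. a n j - \<mu> * c n j) \<longlonglongrightarrow> 0" "Bseq (\<lambda>n. c n j)" if "j < d" for j
    using v_Suc_approx[OF \<mu> that] by (simp_all add: a_def c_def)
  \<comment> \<open>Written as a product, the difference of squares is a null sequence times a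
    bounded one.\<close>
  have "(\<lambda>n. \<Sum>j<d. (a n j - \<mu> * c n j) * (a n j + \<mu> * c n j)) \<longlonglongrightarrow> (\<Sum>j<d. 0)"
  proof (intro tendsto_sum)
    fix j assume "j \<in> {..<d}"
    then have j: "j < d" by simp
    have "Bseq (\<lambda>n. 2 * \<mu> * c n j)" using ac(2)[OF j] \<mu>_pos by (subst Bseq_cmult_iff) auto
    then have "Bseq (\<lambda>n. a n j + \<mu> * c n j)"
      by (rule Bseq_if_diff_tendsto[rotated]) (use ac(1)[OF j] in simp)
    with ac(1)[OF j] show "(\<lambda>n. (a n j - \<mu> * c n j) * (a n j + \<mu> * c n j)) \<longlonglongrightarrow> 0"
      by (rule tendsto_Bseq_mult_zero)
  qed
  moreover have "(\<Sum>j<d. (a n j - \<mu> * c n j) * (a n j + \<mu> * c n j)) = (\<rho> n)\<^sup>2 - \<mu>\<^sup>2 * (\<sigma> n)\<^sup>2" for n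
  proof -
    have "(\<rho> n)\<^sup>2 = (\<Sum>j<d. (a n j)\<^sup>2)" "(\<sigma> n)\<^sup>2 = (\<Sum>j<d. (c n j)\<^sup>2)"
      by (simp_all add: \<rho>_def \<sigma>_def a_def c_def power_divide N_sq[of "Suc n"] M_sq[of "Suc n"] sum_divide_distrib)
    then show ?thesis
      by (simp add: sum_distrib_left power2_eq_square algebra_simps flip: sum_subtractf)
  qed
  ultimately have lim: "(\<lambda>n. (\<rho> n)\<^sup>2 - \<mu>\<^sup>2 * (\<sigma> n)\<^sup>2) \<longlonglongrightarrow> 0" by simp
  obtain K where K: "\<And>n. 1 \<le> K * (\<sigma> n)\<^sup>2" unfolding \<sigma>_def using M_ratio_lower by blast
  have "norm (1 / (\<sigma> n)\<^sup>2) \<le> K" for n using K[of n] pos(2)[of n] by (simp add: divide_simps)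
  then have "Bseq (\<lambda>n. 1 / (\<sigma> n)\<^sup>2)" by (rule BseqI')
  with lim have "(\<lambda>n. ((\<rho> n)\<^sup>2 - \<mu>\<^sup>2 * (\<sigma> n)\<^sup>2) * (1 / (\<sigma> n)\<^sup>2)) \<longlonglongrightarrow> 0"
    by (rule tendsto_Bseq_mult_zero)
  moreover have "((\<rho> n)\<^sup>2 - \<mu>\<^sup>2 * (\<sigma> n)\<^sup>2) * (1 / (\<sigma> n)\<^sup>2) = (\<rho> n / \<sigma> n)\<^sup>2 - \<mu>\<^sup>2" for n
    using pos(2)[of n] by (simp add: field_simps)
  ultimately have "(\<lambda>n. (\<rho> n / \<sigma> n)\<^sup>2 - \<mu>\<^sup>2) \<longlonglongrightarrow> 0" by simp
  then have "(\<lambda>n. (\<rho> n / \<sigma> n)\<^sup>2) \<longlonglongrightarrow> \<mu>\<^sup>2" by (simp only: LIM_zero_iff)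
  then have "(\<lambda>n. sqrt ((\<rho> n / \<sigma> n)\<^sup>2)) \<longlonglongrightarrow> sqrt (\<mu>\<^sup>2)" by (rule tendsto_real_sqrt)
  moreover have "sqrt ((\<rho> n / \<sigma> n)\<^sup>2) = \<rho> n / \<sigma> n" for n
    using pos[of n] by (simp only: real_sqrt_abs) simp
  ultimately show ?thesis using \<mu>_pos by (simp add: \<rho>_def \<sigma>_def)
qed

text \<open>\<open>X n\<close> and its images under \<open>H\<close> all lie in the
  \<open>n\<close>-th interval, so each displacement is at most its length.\<close>

lemma N_le_len: "N n \<le> sqrt (real d) * len n"
proof -
  have "\<bar>v n h\<bar> \<le> len n" if "h \<in> H" for h
    using act_X_between[OF that, of n] act_X_between[OF H_zero, of n] act_zero[OF X_in]
    by (simp add: v_def len_def)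
  then have "(v n (b j))\<^sup>2 \<le> (len n)\<^sup>2" if "j < d" for j
    using power_mono[of "\<bar>v n (b j)\<bar>" "len n" 2] b_in_H[OF that] by simp
  then have "(\<Sum>j<d. (v n (b j))\<^sup>2) \<le> (\<Sum>j<d. (len n)\<^sup>2)" by (intro sum_mono) simp
  then have "N n \<le> sqrt (real d * (len n)\<^sup>2)" unfolding N_def by simp
  then show ?thesis using len_pos[of n] by (simp add: real_sqrt_mult)
qed

text \<open>In the quotient \<open>M n * len n / N n\<close> the factor \<open>\<mu>\<close>
  cancels, so its successive ratios tend to 1. As \<open>len n\<close> dominates \<open>N n\<close>
  up to \<open>sqrt d\<close>, the quotient bounds \<open>M n\<close>.\<close>

theorem \<gamma>_subexponential:
  assumes "r > 1"
  obtains C where "\<And>n j. j < d \<Longrightarrow> \<bar>\<gamma> n j\<bar> \<le> C * r ^ n"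
proof -
  obtain \<mu> where \<mu>: "\<mu> > 0"
    "\<And>h. h \<in> H \<Longrightarrow> \<exists>\<epsilon>. \<epsilon> \<longlonglongrightarrow> \<mu> \<and> (\<forall>n. v (Suc n) h = \<epsilon> n * v n (P (- s) h))"
    "(\<lambda>n. len (Suc n) / len n) \<longlonglongrightarrow> \<mu>"
    using slope_F by blast
  define S where "S n = M n * len n / N n" for n
  have S_pos: "S n > 0" for n using M_pos len_pos N_pos by (simp add: S_def)
  have "(\<lambda>n. (len (Suc n) / len n) / ((N (Suc n) / N n) / (M (Suc n) / M n))) \<longlonglongrightarrow> \<mu> / \<mu>"
    using \<mu>(1) by (intro tendsto_divide \<mu>(3) norm_ratio_tendsto[OF \<mu>(1,2)]) auto
  moreover have "(len (Suc n) / len n) / ((N (Suc n) / N n) / (M (Suc n) / M n)) = S (Suc n) / S n" for n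
    by (simp add: S_def mult_ac)
  ultimately have "(\<lambda>n. S (Suc n) / S n) \<longlonglongrightarrow> 1" using \<mu>(1) by simp
  then obtain C where C: "\<And>n. S n \<le> C * r ^ n"
    using subexponential_if_ratio_tendsto_1[of S, OF S_pos _ assms] by blast
  have "\<bar>\<gamma> n j\<bar> \<le> sqrt (real d) * C * r ^ n" if "j < d" for n j
  proof -
    have "M n * N n \<le> M n * (sqrt (real d) * len n)" using N_le_len M_pos[of n] by simp
    then have "M n \<le> sqrt (real d) * S n" using N_pos[of n] by (simp add: S_def field_simps)
    also have "\<dots> \<le> sqrt (real d) * (C * r ^ n)" using C by (simp add: mult_left_mono)
    finally show ?thesis using abs_\<gamma>_le_M[OF that, of n] by simp
  qed
  then show ?thesis by (rule that)
qed

end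

section \<open>Gaps of the fixed point set and translation numbers\<close>

context affine_action
begin

definition fixed_points :: "real set" where
  "fixed_points = {x \<in> {0..1}. \<forall>h\<in>H. act h x = x}"

text \<open>The inequality for \<open>- h\<close> becomes the reverse inequality for
  \<open>h\<close> after applying the increasing map \<open>act h\<close>.\<close>

lemma fixed_pointsI:
  assumes x: "x \<in> {0..1}" and le: "\<And>h. h \<in> H \<Longrightarrow> act h x \<le> x"
  shows "x \<in> fixed_points"
proof -
  have "act h x = x" if h: "h \<in> H" for h
  proof -
    have "act h (act (- h) x) \<le> act h x"
      using act_le_iff[OF h act_in[OF H_uminus[OF h] x] x] le[OF H_uminus[OF h]] by simp
    then show ?thesis using act_act_uminus[OF h x] le[OF h] by simp
  qed
  then show ?thesis using x by (simp add: fixed_points_def)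
qed

lemma fixed_pointsI':
  assumes x: "x \<in> {0..1}" and ge: "\<And>h. h \<in> H \<Longrightarrow> act h x \<ge> x"
  shows "x \<in> fixed_points"
proof (rule fixed_pointsI[OF x])
  fix h assume h: "h \<in> H"
  have "act h x \<le> act h (act (- h) x)"
    using act_le_iff[OF h x act_in[OF H_uminus[OF h] x]] ge[OF H_uminus[OF h]] by simp
  then show "act h x \<le> x" using act_act_uminus[OF h x] by simp
qed

lemma zero_fixed: "0 \<in> fixed_points" and one_fixed: "1 \<in> fixed_points"
  by (rule fixed_pointsI', simp, use act_in in force) (rule fixed_pointsI, simp, use act_in in force)

lemma F_fixed_points: "x \<in> fixed_points \<Longrightarrow> F n x \<in> fixed_points"
  using F_in act_F P_in_H by (simp add: fixed_points_def)

text \<open>Each increasing map \<open>act h\<close> sends \<open>Sup S\<close> above every fixed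
  \<open>s\<close> in \<open>S\<close>, hence above \<open>Sup S\<close>; a one-sided bound for all
  of \<open>H\<close> suffices.\<close>

lemma Sup_fixed_points:
  assumes S: "S \<subseteq> fixed_points" "S \<noteq> {}"
  shows "Sup S \<in> fixed_points"
proof -
  have bdd: "bdd_above S" using S by (intro bdd_aboveI[of _ 1]) (auto simp: fixed_points_def)
  obtain s where "s \<in> S" using S by blast
  then have in_I: "Sup S \<in> {0..1}"
    using S cSup_upper2[OF _ _ bdd, of s 0] cSup_least[OF S(2), of 1] by (auto simp: fixed_points_def)
  show ?thesis
  proof (rule fixed_pointsI'[OF in_I])
    fix h assume h: "h \<in> H"
    have "s \<le> act h (Sup S)" if "s \<in> S" for s
      using act_le_iff[OF h _ in_I, of s] cSup_upper[OF that bdd] that S h by (auto simp: fixed_points_def)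
    then show "Sup S \<le> act h (Sup S)" using S by (intro cSup_least) auto
  qed
qed

lemma Inf_fixed_points:
  assumes S: "S \<subseteq> fixed_points" "S \<noteq> {}"
  shows "Inf S \<in> fixed_points"
proof -
  have bdd: "bdd_below S" using S by (intro bdd_belowI[of _ 0]) (auto simp: fixed_points_def)
  obtain s where "s \<in> S" using S by blast
  then have in_I: "Inf S \<in> {0..1}"
    using S cInf_lower2[OF _ _ bdd, of s 1] cInf_greatest[OF S(2), of 0] by (auto simp: fixed_points_def)
  show ?thesis
  proof (rule fixed_pointsI[OF in_I])
    fix h assume h: "h \<in> H"
    have "act h (Inf S) \<le> s" if "s \<in> S" for s
      using act_le_iff[OF h in_I, of s] cInf_lower[OF that bdd] that S h by (auto simp: fixed_points_def)
    then show "act h (Inf S) \<le> Inf S" using S by (intro cInf_greatest) auto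
  qed
qed

lemma fixed_points_gap:
  assumes x0: "x0 \<in> {0..1}" "x0 \<notin> fixed_points"
  obtains p q where "p \<in> fixed_points" "q \<in> fixed_points" "p < x0" "x0 < q"
    "\<And>y. y \<in> fixed_points \<Longrightarrow> y \<le> p \<or> q \<le> y"
proof -
  define S where "S = {y \<in> fixed_points. y \<le> x0}"
  define R where "R = {y \<in> fixed_points. x0 \<le> y}"
  have S: "S \<subseteq> fixed_points" "S \<noteq> {}" using zero_fixed x0 by (auto simp: S_def)
  have R: "R \<subseteq> fixed_points" "R \<noteq> {}" using one_fixed x0 by (auto simp: R_def)
  have p: "Sup S \<in> fixed_points" and q: "Inf R \<in> fixed_points"
    using Sup_fixed_points[OF S] Inf_fixed_points[OF R] .
  have "Sup S \<le> x0" using S(2) by (intro cSup_least) (auto simp: S_def)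
  moreover have "x0 \<le> Inf R" using R(2) by (intro cInf_greatest) (auto simp: R_def)
  moreover have "y \<le> Sup S \<or> Inf R \<le> y" if "y \<in> fixed_points" for y
  proof (cases "y \<le> x0")
    case True
    then have "y \<le> Sup S" using that by (intro cSup_upper bdd_aboveI[of _ x0]) (auto simp: S_def)
    then show ?thesis ..
  next
    case False
    then have "Inf R \<le> y" using that by (intro cInf_lower bdd_belowI[of _ x0]) (auto simp: R_def)
    then show ?thesis ..
  qed
  ultimately show ?thesis using that p q x0(2) by (metis less_le)
qed

text \<open>
  Among the basis vectors and their opposites, the one whose forward orbit of \<open>x0\<close> has the largest
  supremum works: that supremum is then fixed by all of \<open>H\<close>.
\<close>

lemma exists_archimedean_element:
  assumes d: "d \<ge> 1" and x0: "x0 \<in> {0..1}"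
    and q: "\<And>y. y \<in> fixed_points \<Longrightarrow> x0 \<le> y \<Longrightarrow> q \<le> y"
  obtains e where "e \<in> H" "\<And>x. x < q \<Longrightarrow> \<exists>k::nat. x < act (of_nat k \<cdot>\<^sub>v e) x0"
proof -
  define E where "E = b ` {..<d} \<union> (\<lambda>j. - b j) ` {..<d}"
  define y where "y g = (SUP k::nat. act (of_nat k \<cdot>\<^sub>v g) x0)" for g
  have E_H: "g \<in> H" if "g \<in> E" for g using that b_in_H H_uminus by (auto simp: E_def)
  have orbit_in: "act (of_nat k \<cdot>\<^sub>v g) x0 \<in> {0..1}" if "g \<in> H" for g k
    using act_in[OF H_smult_nat[OF that] x0] .
  have bdd: "bdd_above (range (\<lambda>k::nat. act (of_nat k \<cdot>\<^sub>v g) x0))" if "g \<in> H" for g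
    using orbit_in[OF that] by (intro bdd_aboveI[of _ 1]) auto
  have le_y: "act (of_nat k \<cdot>\<^sub>v g) x0 \<le> y g" if "g \<in> H" for g k
    unfolding y_def by (rule cSUP_upper[OF _ bdd[OF that]]) simp
  have "finite E" "E \<noteq> {}" using d by (auto simp: E_def lessThan_empty_iff)
  then have "Max (y ` E) \<in> y ` E" "\<And>g. g \<in> E \<Longrightarrow> y g \<le> Max (y ` E)" by (auto intro!: Max_in)
  then obtain e where e: "e \<in> E" "\<And>g. g \<in> E \<Longrightarrow> y g \<le> y e" by auto
  have eH: "e \<in> H" using E_H e by blast
  have "y e \<le> 1" unfolding y_def by (rule cSUP_least) (use orbit_in[OF eH] in auto)
  moreover have x0_le: "x0 \<le> y e" using le_y[OF eH, of 0] act_zero_smult[OF eH x0] by simp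
  ultimately have y_in: "y e \<in> {0..1}" using x0 by auto
  \<comment> \<open>If \<open>g\<close> moves the supremum \<open>y e\<close> up, then its preimage
    under \<open>g\<close> lies strictly below \<open>y e\<close>, hence below some orbit point, and
    \<open>g\<close> carries that orbit point beyond \<open>y e\<close>.\<close>
  have push: "\<exists>k. y e < act g (act (of_nat k \<cdot>\<^sub>v e) x0)" if g: "g \<in> H" and gt: "act g (y e) > y e" for g
  proof -
    have gy: "act (- g) (y e) \<in> {0..1}" using act_in[OF H_uminus[OF g] y_in] .
    have "act (- g) (y e) < act (- g) (act g (y e))"
      using act_less_iff[OF H_uminus[OF g] y_in act_in[OF g y_in]] gt by simp
    then have "act (- g) (y e) < y e" using act_uminus_act[OF g y_in] by simp
    then obtain k where k: "act (- g) (y e) < act (of_nat k \<cdot>\<^sub>v e) x0"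
      using less_cSUP_iff[OF _ bdd[OF eH], of "act (- g) (y e)"] unfolding y_def by auto
    then have "act g (act (- g) (y e)) < act g (act (of_nat k \<cdot>\<^sub>v e) x0)"
      using act_less_iff[OF g gy orbit_in[OF eH]] by simp
    then show ?thesis using act_act_uminus[OF g y_in] by auto
  qed
  have "act e (y e) \<le> y e"
  proof (rule ccontr)
    assume "\<not> act e (y e) \<le> y e"
    then obtain k where "y e < act e (act (of_nat k \<cdot>\<^sub>v e) x0)" using push[OF eH] by auto
    then show False using le_y[OF eH, of "Suc k"] unfolding act_Suc_smult[OF eH x0] by linarith
  qed
  then have pow_le: "act (of_nat k \<cdot>\<^sub>v e) (y e) \<le> y e" for k
  proof (induction k)
    case 0
    show ?case using act_zero_smult[OF eH y_in] by simp
  next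
    case (Suc k)
    then have "act e (act (of_nat k \<cdot>\<^sub>v e) (y e)) \<le> act e (y e)"
      using act_le_iff[OF eH act_in[OF H_smult_nat[OF eH] y_in] y_in] by blast
    then show ?case using Suc.prems unfolding act_Suc_smult[OF eH y_in] by linarith
  qed
  have le: "act g (y e) \<le> y e" if g: "g \<in> E" for g
  proof (rule ccontr)
    have gH: "g \<in> H" using g E_H by blast
    assume "\<not> act g (y e) \<le> y e"
    then obtain k where k: "y e < act g (act (of_nat k \<cdot>\<^sub>v e) x0)" using push[OF gH] by auto
    \<comment> \<open>By maximality of \<open>y e\<close>, the point \<open>act g x0\<close> lies
      below it. Since \<open>g\<close> commutes with the multiples of \<open>e\<close>, which do not
      raise \<open>y e\<close>, the pushed orbit point cannot lie beyond \<open>y e\<close>.\<close>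
    have "of_nat 1 \<cdot>\<^sub>v g = g" by simp
    then have "act g x0 \<le> y e" using le_y[OF gH, of 1] e(2)[OF g] by simp
    then have "act (of_nat k \<cdot>\<^sub>v e) (act g x0) \<le> act (of_nat k \<cdot>\<^sub>v e) (y e)"
      using act_le_iff[OF H_smult_nat[OF eH] act_in[OF gH x0] y_in] by simp
    then show False
      using k pow_le[of k] act_commute[OF gH H_smult_nat[OF eH] x0] by (metis linorder_not_less order_trans)
  qed
  have "act (b j) (y e) = y e" if j: "j < d" for j
  proof -
    have "b j \<in> E" "- b j \<in> E" using j by (auto simp: E_def)
    then have "act (b j) (y e) \<le> y e" "act (- b j) (y e) \<le> y e" using le by blast+
    moreover have "act (b j) (act (- b j) (y e)) \<le> act (b j) (y e)"
      using act_le_iff[OF b_in_H[OF j] act_in[OF H_uminus[OF b_in_H[OF j]] y_in] y_in] calculation by simp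
    ultimately show ?thesis using act_act_uminus[OF b_in_H[OF j] y_in] by simp
  qed
  then have "y e \<in> fixed_points" using H_fixes_if_basis_fixes[OF y_in] y_in by (simp add: fixed_points_def)
  then have "q \<le> y e" using q x0_le by blast
  have "\<exists>k::nat. x < act (of_nat k \<cdot>\<^sub>v e) x0" if "x < q" for x
    using less_cSUP_iff[OF _ bdd[OF eH], of x] that \<open>q \<le> y e\<close> unfolding y_def by auto
  then show ?thesis using that eH by blast
qed

text \<open>Hoelder's construction is applied to the preorder that compares elements of
  \<open>H\<close> by the images of \<open>x0\<close>. The multiples of \<open>e\<close> are
  cofinal: they carry \<open>x0\<close> past any point below \<open>q\<close>, and each image of
  \<open>x0\<close> stays below the fixed point \<open>q\<close>.\<close>

lemma exists_translation_number:
  assumes d: "d \<ge> 1" and x0: "x0 \<in> {0..1}" and q: "q \<in> fixed_points" "x0 < q"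
    and gap: "\<And>y. y \<in> fixed_points \<Longrightarrow> x0 \<le> y \<Longrightarrow> q \<le> y"
  obtains \<tau> :: "rat vec \<Rightarrow> real" and e
  where "\<And>h k. h \<in> H \<Longrightarrow> k \<in> H \<Longrightarrow> \<tau> (h + k) = \<tau> h + \<tau> k"
    and "e \<in> H" "\<tau> e = 1" and "\<And>h. h \<in> H \<Longrightarrow> \<tau> h > 0 \<Longrightarrow> act h x0 > x0"
proof -
  obtain e where e: "e \<in> H" "\<And>x. x < q \<Longrightarrow> \<exists>k::nat. x < act (of_nat k \<cdot>\<^sub>v e) x0"
    using exists_archimedean_element[OF d x0 gap] by blast
  have q_in: "q \<in> {0..1}" and q_fix: "\<And>h. h \<in> H \<Longrightarrow> act h q = q"
    using q by (auto simp: fixed_points_def)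
  interpret Q: comm_group "rat_space d" by (rule comm_group_vec)
  let ?K = "(rat_space d)\<lparr>carrier := H\<rparr>"
  interpret K: comm_group ?K
    by (rule group.group_comm_groupI[OF subgroup.subgroup_is_group[OF subgroup_H Q.is_group]])
      (use H_carrier in \<open>auto simp: monoid_vec_def intro!: comm_add_vec\<close>)
  define N where "N = {h \<in> H. act h x0 \<ge> x0}"
  have inv_K: "inv\<^bsub>?K\<^esub> h = - h" if "h \<in> H" for h
    using Q.m_inv_consistent[OF subgroup_H that] inv_rat_space[OF H_carrier[OF that]] by simp
  have mult_Q: "h \<otimes>\<^bsub>rat_space d\<^esub> k = h + k" for h k by (simp add: monoid_vec_def)
  then have mult_K: "h \<otimes>\<^bsub>?K\<^esub> k = h + k" for h k by simp
  have pow_K: "h [^]\<^bsub>?K\<^esub> (k::nat) = of_nat k \<cdot>\<^sub>v h" if "h \<in> H" for h k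
  proof (induction k)
    case 0
    have "of_nat 0 \<cdot>\<^sub>v h = 0\<^sub>v d" using H_dim[OF that] by auto
    then show ?case by (simp add: monoid_vec_def)
  next
    case (Suc k)
    have "of_nat (Suc k) \<cdot>\<^sub>v h = of_nat k \<cdot>\<^sub>v h + h"
      using H_dim[OF that] by (auto simp: algebra_simps)
    then show ?case using Suc by (simp add: mult_Q)
  qed
  have act_neg: "act (- h) x0 \<ge> x0 \<longleftrightarrow> act h x0 \<le> x0" if "h \<in> H" for h
    using act_le_iff[OF that x0 act_in[OF H_uminus[OF that] x0]] act_act_uminus[OF that x0] by simp
  have N_sub: "N \<subseteq> carrier ?K" by (auto simp: N_def)
  have N_one: "\<one>\<^bsub>?K\<^esub> \<in> N" using H_zero act_zero[OF x0] by (simp add: N_def monoid_vec_def)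
  have N_mult: "g \<otimes>\<^bsub>?K\<^esub> h \<in> N" if "g \<in> N" "h \<in> N" for g h
  proof -
    have "act g x0 \<le> act g (act h x0)"
      using that act_le_iff[OF _ x0 act_in[OF _ x0]] by (simp add: N_def)
    then show ?thesis using that act_add[OF _ _ x0] H_add by (simp add: N_def mult_Q)
  qed
  have N_total: "g \<in> N \<or> inv\<^bsub>?K\<^esub> g \<in> N" if "g \<in> carrier ?K" for g
    using that act_neg H_uminus by (auto simp: N_def inv_K)
  have e_K: "e \<in> carrier ?K" using e by simp
  have e_N: "inv\<^bsub>?K\<^esub> e \<notin> N"
  proof
    assume "inv\<^bsub>?K\<^esub> e \<in> N"
    then have le: "act e x0 \<le> x0" using e act_neg by (simp add: N_def inv_K)
    have "act (of_nat k \<cdot>\<^sub>v e) x0 \<le> x0" for k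
    proof (induction k)
      case 0
      show ?case using act_zero_smult[OF e(1) x0] by simp
    next
      case (Suc k)
      then have "act e (act (of_nat k \<cdot>\<^sub>v e) x0) \<le> act e x0"
        using act_le_iff[OF e(1) act_in[OF H_smult_nat[OF e(1)] x0] x0] by blast
      then show ?case using le unfolding act_Suc_smult[OF e(1) x0] by linarith
    qed
    then show False using e(2)[OF q(2)] by (meson linorder_not_less)
  qed
  have N_arch: "\<exists>m::nat. e [^]\<^bsub>?K\<^esub> m \<otimes>\<^bsub>?K\<^esub> inv\<^bsub>?K\<^esub> g \<in> N" if "g \<in> carrier ?K" for g
  proof -
    have g: "g \<in> H" using that by simp
    have gx: "act g x0 \<in> {0..1}" using act_in[OF g x0] .
    have "act g x0 < act g q" using act_less_iff[OF g x0 q_in] q by simp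
    then have "act g x0 < q" using q_fix[OF g] by simp
    then obtain k :: nat where k: "act g x0 < act (of_nat k \<cdot>\<^sub>v e) x0" using e(2) by blast
    have kH: "of_nat k \<cdot>\<^sub>v e \<in> H" using H_smult_nat e by blast
    have "act (- g) (act g x0) \<le> act (- g) (act (of_nat k \<cdot>\<^sub>v e) x0)"
      using act_le_iff[OF H_uminus[OF g] gx act_in[OF kH x0]] k by simp
    then have "x0 \<le> act (of_nat k \<cdot>\<^sub>v e + - g) x0"
      using act_uminus_act[OF g x0] act_add[OF kH H_uminus[OF g] x0] act_commute[OF kH H_uminus[OF g] x0]
      by simp
    then show ?thesis
      using H_add[OF kH H_uminus[OF g]] by (intro exI[of _ k]) (simp only: N_def inv_K[OF g] pow_K[OF e(1)] mult_K, simp)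
  qed
  obtain \<tau> :: "rat vec \<Rightarrow> real" where \<tau>:
    "\<And>g h. g \<in> carrier ?K \<Longrightarrow> h \<in> carrier ?K \<Longrightarrow> \<tau> (g \<otimes>\<^bsub>?K\<^esub> h) = \<tau> g + \<tau> h"
    "\<tau> e = 1" "\<And>g. g \<in> carrier ?K \<Longrightarrow> \<tau> g > 0 \<Longrightarrow> inv\<^bsub>?K\<^esub> g \<notin> N"
    using K.exists_translation_hom[OF N_sub N_one N_mult N_total e_K e_N N_arch] by blast
  show ?thesis
  proof (rule that[of \<tau> e])
    show "\<tau> (h + k) = \<tau> h + \<tau> k" if "h \<in> H" "k \<in> H" for h k using \<tau>(1)[of h k] that by (simp add: mult_Q)
    show "act h x0 > x0" if "h \<in> H" "\<tau> h > 0" for h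
      using \<tau>(3)[of h] that act_neg[OF that(1)] H_uminus[OF that(1)] by (auto simp: N_def inv_K)
  qed (fact e(1) \<tau>(2))+
qed

text \<open>Once the interval is moved off itself, its successive images march in one direction, and
  the orbits of the two end points interlace. A bounded monotone sequence and a sandwich give the
  common limit.\<close>

lemma escaping_limit:
  assumes pq: "p \<in> {0..1}" "q \<in> {0..1}" "p < q" and esc: "q \<le> F s p \<or> F s q \<le> p"
  obtains w where "w \<in> {0..1}" "(\<lambda>n. F (s * int n) p) \<longlonglongrightarrow> w" "(\<lambda>n. F (s * int n) q) \<longlonglongrightarrow> w"
proof -
  have Suc_F: "F (s * int (Suc n)) x = F (s * int n) (F s x)" if "x \<in> {0..1}" for n x
    using that by (simp add: F_F algebra_simps)
  have less: "F (s * int n) p < F (s * int n) q" for n using F_less_iff pq by simp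
  have bound: "0 \<le> F (s * int n) x" "F (s * int n) x \<le> 1" if "x \<in> {0..1}" for n x
    using F_in[OF that] by auto
  have in_I: "w \<in> {0..1}" if "(\<lambda>n. F (s * int n) p) \<longlonglongrightarrow> w" for w
    using LIMSEQ_le_const[OF that] LIMSEQ_le_const2[OF that] bound[OF pq(1)] by auto
  show ?thesis using esc
  proof
    assume "q \<le> F s p"
    then have step: "F (s * int n) q \<le> F (s * int (Suc n)) p" for n
      unfolding Suc_F[OF pq(1)] using F_le_iff F_in pq by simp
    then have "F (s * int n) p \<le> F (s * int (Suc n)) p" for n using less[of n] step[of n] by linarith
    then have "incseq (\<lambda>n. F (s * int n) p)" by (rule incseq_SucI)
    moreover have "\<forall>n. F (s * int n) p \<le> 1" using bound[OF pq(1)] by simp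
    ultimately obtain w where w: "(\<lambda>n. F (s * int n) p) \<longlonglongrightarrow> w" "\<forall>n. F (s * int n) p \<le> w"
      by (rule incseq_convergent)
    have "(\<lambda>n. F (s * int n) q) \<longlonglongrightarrow> w"
      using less step
      by (intro real_tendsto_sandwich[OF _ _ w(1) LIMSEQ_Suc[OF w(1)]] always_eventually allI) (auto intro: less_imp_le)
    then show ?thesis using that w in_I by blast
  next
    assume "F s q \<le> p"
    then have step: "F (s * int (Suc n)) q \<le> F (s * int n) p" for n
      unfolding Suc_F[OF pq(2)] using F_le_iff F_in pq by simp
    then have "F (s * int (Suc n)) q \<le> F (s * int n) q" for n using less[of n] step[of n] by linarith
    then have "decseq (\<lambda>n. F (s * int n) q)" by (rule decseq_SucI)
    moreover have "\<forall>n. 0 \<le> F (s * int n) q" using bound[OF pq(2)] by simp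
    ultimately obtain w where w: "(\<lambda>n. F (s * int n) q) \<longlonglongrightarrow> w" "\<forall>n. w \<le> F (s * int n) q"
      by (rule decseq_convergent)
    have "(\<lambda>n. F (s * int n) p) \<longlonglongrightarrow> w"
      using less step
      by (intro real_tendsto_sandwich[OF _ _ LIMSEQ_Suc[OF w(1)] w(1)] always_eventually allI) (auto intro: less_imp_le)
    then show ?thesis using that w in_I by blast
  qed
qed

lemma \<phi>_eq: "h \<in> H \<Longrightarrow> x \<in> {0..1} \<Longrightarrow> \<phi> (m, h) x = act h (F m x)"
  unfolding act_def F_def using \<phi>_mult[of x h "0\<^sub>v d" 0 m] H_zero H_carrier[of h] by (simp add: P_zero_vec)

lemma F_fixed_if_generator_fixed:
  assumes x: "x \<in> {0..1}" and fx: "F 1 x = x"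
  shows "F m x = x"
proof -
  have nat: "F (int n) x = x" for n
  proof (induction n)
    case 0
    show ?case using F_zero[OF x] by simp
  next
    case (Suc n)
    then show ?case using F_F[OF x, of 1 "int n"] fx by simp
  qed
  show ?thesis
  proof (cases m rule: int_cases2)
    case (nonpos n)
    then show ?thesis using nat[of n] F_F[OF x, of "- int n" "int n"] F_zero[OF x] by simp
  qed (simp add: nat)
qed

text \<open>\<open>F 1\<close> permutes the fixed points of \<open>H\<close> and hence the gaps
  between them. A gap mapped to itself would have global fixed points as ends, so it would be all of
  \<open>(0, 1)\<close>, which contains the fixed point \<open>z\<close>.\<close>

lemma gap_escapes:
  assumes no_fix: "\<not> (\<exists>x\<in>{0<..<1}. global_fixed_point \<phi> (carrier G) x)"
    and z: "z \<in> fixed_points" "0 < z" "z < 1"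
    and p: "p \<in> fixed_points" and q: "q \<in> fixed_points" and pq: "p < q"
    and gap: "\<And>y. y \<in> fixed_points \<Longrightarrow> y \<le> p \<or> q \<le> y"
  shows "q \<le> F 1 p \<and> F (- 1) q \<le> p \<or> F 1 q \<le> p \<and> q \<le> F (- 1) p"
proof -
  have p_in: "p \<in> {0..1}" and q_in: "q \<in> {0..1}" using p q by (auto simp: fixed_points_def)
  have inv: "F (- 1) (F 1 x) = x" "F 1 (F (- 1) x) = x" if "x \<in> {0..1}" for x
    using that F_zero by (simp_all add: F_F)
  consider "q \<le> F 1 p" | "F 1 q \<le> p" | "F 1 p \<le> p" "q \<le> F 1 q"
    using gap[OF F_fixed_points[OF p, of 1]] gap[OF F_fixed_points[OF q, of 1]] by blast
  then show ?thesis
  proof cases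
    case 1
    then show ?thesis using F_le_iff[OF q_in F_in[OF p_in], of "- 1" 1] inv(1)[OF p_in] by simp
  next
    case 2
    then show ?thesis using F_le_iff[OF F_in[OF q_in] p_in, of "- 1" 1] inv(1)[OF q_in] by simp
  next
    case 3
    \<comment> \<open>Pulled back by \<open>F (- 1)\<close>, the ends are fixed points of
      \<open>H\<close> in \<open>[p, q]\<close> and still distinct; since the gap contains no fixed
      points, they are \<open>p\<close> and \<open>q\<close> again.\<close>
    have "p \<le> F (- 1) p" "F (- 1) q \<le> q"
      using 3 F_le_iff[OF F_in[OF p_in] p_in, of "- 1" 1] F_le_iff[OF q_in F_in[OF q_in], of "- 1" 1]
        inv(1)[OF p_in] inv(1)[OF q_in] by simp_all
    moreover have "F (- 1) p < F (- 1) q" using F_less_iff[OF p_in q_in] pq by simp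
    ultimately have "F (- 1) p = p" "F (- 1) q = q"
      using gap[OF F_fixed_points[OF p, of "- 1"]] gap[OF F_fixed_points[OF q, of "- 1"]] pq by linarith+
    then have F_pq: "F 1 p = p" "F 1 q = q" using inv(2)[OF p_in] inv(2)[OF q_in] by simp_all
    have fixed: "global_fixed_point \<phi> (carrier G) x" if "x = p \<or> x = q" for x
      unfolding global_fixed_point_def
    proof
      fix g assume "g \<in> carrier G"
      then obtain m h where g: "g = (m, h)" "h \<in> H" using carrier_G by (cases g) auto
      have x: "x \<in> fixed_points" "F 1 x = x" using that p q F_pq by auto
      then have "F m x = x" "act h x = x"
        using F_fixed_if_generator_fixed[of x m] g by (auto simp: fixed_points_def)
      then show "\<phi> g x = x" using \<phi>_eq[of h x m] x g by (simp add: fixed_points_def)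
    qed
    have "p = 0" "q = 1"
      using no_fix fixed[of p] fixed[of q] p_in q_in pq by (force simp: less_le)+
    then show ?thesis using gap[OF z(1)] z by simp
  qed
qed

end

section \<open>Vanishing of the translation number and the contradiction\<close>

context C1_affine_action
begin

text \<open>The functionals \<open>\<tau> \<circ> A^n\<close>, viewed as row vectors, form an orbit
  of right multiplication by \<open>A\<close>. Subexponential growth in both directions forces such
  an orbit to vanish.\<close>

lemma translation_zero:
  fixes \<tau> :: "rat vec \<Rightarrow> real"
  assumes hyp: "\<And>z. eigenvalue (map_mat of_rat A :: complex mat) z \<Longrightarrow> cmod z \<noteq> 1"
    and \<tau>_add: "\<And>h k. h \<in> H \<Longrightarrow> k \<in> H \<Longrightarrow> \<tau> (h + k) = \<tau> h + \<tau> k"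
    and growth: "\<And>r. r > 1 \<Longrightarrow> \<exists>C. \<forall>n. \<forall>j<d. \<bar>\<tau> (P n (b j))\<bar> \<le> C * r ^ nat \<bar>n\<bar>"
    and h: "h \<in> H"
  shows "\<tau> h = 0"
proof -
  define B :: "complex mat" where "B = map_mat of_rat A"
  have A_carrier: "A \<in> carrier_mat d d" using A by (rule GL_rat_carrier)
  have of_real_of_rat: "complex_of_real (of_rat a) = of_rat a" for a
    by (induct a) (simp add: of_rat_rat)
  \<comment> \<open>Division by \<open>c j\<close> passes from the basis \<open>b\<close> to the
    unit vectors, so that the recursion has the matrix \<open>B\<close> itself and not a
    conjugate.\<close>
  define y :: "int \<Rightarrow> nat \<Rightarrow> complex" where "y n j = of_real (\<tau> (P n (b j)) / of_rat (c j))" for n j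
  have \<tau>_P: "\<tau> (P n g) = (\<Sum>i<d. coord g i * \<tau> (P n (b i)))" if "g \<in> H" for n g
    using that by (intro additive_eq_coord_sum) (simp_all add: P_add P_in_H \<tau>_add)
  have y_0: "y n j = 0" if "j < d" for n j
  proof (rule bi_subexponential_orbit_eq_0[of B d])
    show "B \<in> carrier_mat d d" using A_carrier by (simp add: B_def)
    show "cmod z \<noteq> 1" if "eigenvalue B z" for z using hyp that by (simp add: B_def)
    show "y (n + 1) k = (\<Sum>i<d. y n i * B $$ (i, k))" if k: "k < d" for n k
    proof -
      have bk: "b k \<in> H" using b_in_H k by blast
      have "P (n + 1) (b k) = P n (A *\<^sub>v b k)" using P_P[OF bk, of n 1] by (simp add: P_1)
      moreover have "A *\<^sub>v b k \<in> H" using P_in_H[OF bk, of 1] by (simp add: P_1)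
      ultimately have eq: "\<tau> (P (n + 1) (b k)) = (\<Sum>i<d. coord (A *\<^sub>v b k) i * \<tau> (P n (b i)))"
        using \<tau>_P by simp
      have "coord (A *\<^sub>v b k) i = of_rat (A $$ (i, k)) * of_rat (c k) / of_rat (c i)" if "i < d" for i
      proof -
        have "row A i \<bullet> (c k \<cdot>\<^sub>v unit_vec d k) = c k * (row A i \<bullet> unit_vec d k)"
          using that A_carrier by (intro scalar_prod_smult_distrib[of _ d]) auto
        then have "(A *\<^sub>v b k) $ i = A $$ (i, k) * c k"
          using that k A_carrier by (simp add: b_def)
        then show ?thesis by (simp add: coord_def of_rat_mult of_rat_divide)
      qed
      then have "\<tau> (P (n + 1) (b k)) / of_rat (c k) = (\<Sum>i<d. \<tau> (P n (b i)) / of_rat (c i) * of_rat (A $$ (i, k)))"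
        unfolding eq sum_divide_distrib using c_nz[OF k] by (intro sum.cong) (auto simp: field_simps)
      then have "y (n + 1) k = (\<Sum>i<d. complex_of_real (\<tau> (P n (b i)) / of_rat (c i) * of_rat (A $$ (i, k))))"
        by (simp add: y_def)
      also have "\<dots> = (\<Sum>i<d. y n i * B $$ (i, k))"
        using A_carrier k by (intro sum.cong) (auto simp: y_def B_def of_real_of_rat)
      finally show ?thesis .
    qed
    show "bi_subexponential (\<lambda>n. y n j)" if j: "j < d" for j
      unfolding bi_subexponential_def
    proof (intro allI impI)
      fix r :: real assume "r > 1"
      then obtain C where C: "\<And>n j. j < d \<Longrightarrow> \<bar>\<tau> (P n (b j))\<bar> \<le> C * r ^ nat \<bar>n\<bar>"
        using growth by blast
      have "cmod (y n j) \<le> C / \<bar>of_rat (c j)\<bar> * r ^ nat \<bar>n\<bar>" for n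
        using divide_right_mono[OF C[OF j, of n], of "\<bar>of_rat (c j)\<bar>"] by (simp add: y_def norm_divide)
      then show "\<exists>C. \<forall>n. cmod (y n j) \<le> C * r ^ nat \<bar>n\<bar>" by blast
    qed
  qed (rule that)
  have "\<tau> (P 0 (b j)) = 0" if "j < d" for j using y_0[OF that, of 0] c_nz[OF that] by (simp add: y_def)
  then show ?thesis using \<tau>_P[OF h, of 0] P_0[OF h] by simp
qed

lemma no_C1_action:
  assumes d: "d \<ge> 1"
    and hyp: "\<And>z. eigenvalue (map_mat of_rat A :: complex mat) z \<Longrightarrow> cmod z \<noteq> 1"
    and no_fix: "\<not> (\<exists>x\<in>{0<..<1}. global_fixed_point \<phi> (carrier G) x)"
    and x0: "x0 \<in> {0..1}" "x0 \<notin> fixed_points"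
    and z: "z \<in> fixed_points" "0 < z" "z < 1"
  shows False
proof -
  obtain p q where p: "p \<in> fixed_points" and q: "q \<in> fixed_points" and pq: "p < x0" "x0 < q"
    and gap: "\<And>y. y \<in> fixed_points \<Longrightarrow> y \<le> p \<or> q \<le> y"
    using fixed_points_gap[OF x0] by blast
  have p_in: "p \<in> {0..1}" and q_in: "q \<in> {0..1}" using p q by (auto simp: fixed_points_def)
  have gap': "q \<le> y" if "y \<in> fixed_points" "x0 \<le> y" for y using gap[OF that(1)] that(2) pq by linarith
  obtain \<tau> :: "rat vec \<Rightarrow> real" and e
    where \<tau>: "\<And>h k. h \<in> H \<Longrightarrow> k \<in> H \<Longrightarrow> \<tau> (h + k) = \<tau> h + \<tau> k"
      and e: "e \<in> H" "\<tau> e = 1" and \<tau>_pos: "\<And>h. h \<in> H \<Longrightarrow> \<tau> h > 0 \<Longrightarrow> act h x0 > x0"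
    using exists_translation_number[OF d x0(1) q pq(2) gap'] by blast
  have half: "\<exists>C. \<forall>n. \<forall>j<d. \<bar>\<tau> (P (- (s * int n)) (b j))\<bar> \<le> C * r ^ n"
    if s: "s = 1 \<or> s = - 1" and r: "r > 1" for s and r :: real
  proof -
    have "q \<le> F s p \<or> F s q \<le> p"
      using gap_escapes[OF no_fix z p q less_trans[OF pq] gap] s by auto
    then obtain w where w: "w \<in> {0..1}" "(\<lambda>n. F (s * int n) p) \<longlonglongrightarrow> w" "(\<lambda>n. F (s * int n) q) \<longlonglongrightarrow> w"
      using escaping_limit[OF p_in q_in less_trans[OF pq]] by blast
    interpret escaping_interval d H c A \<phi> s p q x0 w \<tau> e
      by (intro escaping_interval.intro[OF C1_affine_action_axioms] escaping_interval_axioms.intro)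
        (use s p_in q_in w pq p q \<tau> \<tau>_pos e in \<open>auto simp: fixed_points_def\<close>)
    obtain C where "\<And>n j. j < d \<Longrightarrow> \<bar>\<gamma> n j\<bar> \<le> C * r ^ n" using \<gamma>_subexponential[OF r] by blast
    then show ?thesis by (auto simp: \<gamma>_def T_def)
  qed
  have "\<tau> e = 0"
  proof (rule translation_zero[OF hyp \<tau> _ e(1)])
    \<comment> \<open>The end of the orbit in direction \<open>s = 1\<close> bounds the negative
      powers of \<open>A\<close>, and \<open>s = - 1\<close> bounds the positive ones, since
      \<open>T\<close> contains the inverse power.\<close>
    fix r :: real assume r: "r > 1"
    obtain K1 where K1: "\<And>n j. j < d \<Longrightarrow> \<bar>\<tau> (P (- int n) (b j))\<bar> \<le> K1 * r ^ n"
      using half[of 1 r] r by auto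
    obtain K2 where K2: "\<And>n j. j < d \<Longrightarrow> \<bar>\<tau> (P (int n) (b j))\<bar> \<le> K2 * r ^ n"
      using half[of "- 1" r] r by auto
    have "\<bar>\<tau> (P n (b j))\<bar> \<le> max K1 K2 * r ^ nat \<bar>n\<bar>" if j: "j < d" for n j
    proof (cases n rule: int_cases2)
      case (nonneg m)
      have "\<bar>\<tau> (P n (b j))\<bar> \<le> K2 * r ^ m" using K2[OF j, of m] nonneg by simp
      also have "\<dots> \<le> max K1 K2 * r ^ m" using r by (intro mult_right_mono) auto
      finally show ?thesis using nonneg by simp
    next
      case (nonpos m)
      have "\<bar>\<tau> (P n (b j))\<bar> \<le> K1 * r ^ m" using K1[OF j, of m] nonpos by simp
      also have "\<dots> \<le> max K1 K2 * r ^ m" using r by (intro mult_right_mono) auto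
      finally show ?thesis using nonpos by simp
    qed
    then show "\<exists>C. \<forall>n. \<forall>j<d. \<bar>\<tau> (P n (b j))\<bar> \<le> C * r ^ nat \<bar>n\<bar>" by blast
  qed
  then show False using e(2) by simp
qed

end

theorem proposition1p5:
  fixes d :: nat and A :: "rat mat" and H :: "rat vec set"
    and \<phi> :: "int \<times> rat vec \<Rightarrow> real \<Rightarrow> real"
  defines "G \<equiv> int_semidirect d A H"
  assumes "d \<ge> 1"
    and "A \<in> carrier (GL_rat d)"
    and "\<And>z. eigenvalue (map_mat of_rat A :: complex mat) z \<Longrightarrow> cmod z \<noteq> 1"
    and "subgroup H (rat_space d)"
    and "(\<lambda>v. A *\<^sub>v v) ` H = H"
    and "rat_rank ((rat_space d)\<lparr>carrier := H\<rparr>) = d"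
    and "group_action G {0..1} \<phi>"
    and "\<And>g. g \<in> carrier G \<Longrightarrow> orientation_preserving_homeo {0..1} (\<phi> g)"
    and "\<not> (\<exists>x\<in>{0<..<1}. global_fixed_point \<phi> (carrier G) x)"
    and "\<not> acts_trivially \<phi> (base_subgroup H) {0..1}"
    and "\<exists>x\<in>{0<..<1}. global_fixed_point \<phi> (base_subgroup H) x"
  shows "\<not> (\<forall>g\<in>carrier G. C1_diffeo {0..1} (\<phi> g))"
proof
  assume C1: "\<forall>g\<in>carrier G. C1_diffeo {0..1} (\<phi> g)"
  interpret rat_subgroup d H by (rule rat_subgroup.intro) fact
  \<comment> \<open>The locale takes \<open>c\<close> as a function on all naturals, so the choice
    is made for every \<open>k\<close>, with no condition beyond the dimension.\<close>
  have "\<forall>k. \<exists>c. k < d \<longrightarrow> c \<noteq> 0 \<and> c \<cdot>\<^sub>v unit_vec d k \<in> H"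
    using axis_in_H_if_rank[OF \<open>rat_rank _ = d\<close>] by metis
  then obtain c where c: "\<And>k. k < d \<Longrightarrow> c k \<noteq> 0 \<and> c k \<cdot>\<^sub>v unit_vec d k \<in> H" by metis
  interpret C1_affine_action d H c A \<phi>
    by (intro C1_affine_action.intro affine_action.intro full_rank_subgroup.intro rat_subgroup_axioms
        full_rank_subgroup_axioms.intro affine_action_axioms.intro C1_affine_action_axioms.intro)
      (use assms(3,6,8,9) C1 c in \<open>simp_all add: G_def\<close>)
  obtain x0 where "x0 \<in> {0..1}" "x0 \<notin> fixed_points"
    using \<open>\<not> acts_trivially _ _ _\<close>
    unfolding acts_trivially_def global_fixed_point_def base_subgroup_def fixed_points_def act_def by blast
  moreover obtain z where "z \<in> fixed_points" "0 < z" "z < 1"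
    using \<open>\<exists>x\<in>{0<..<1}. global_fixed_point \<phi> (base_subgroup H) x\<close>
    by (auto simp: global_fixed_point_def base_subgroup_def fixed_points_def act_def)
  ultimately show False
    using no_C1_action[OF \<open>d \<ge> 1\<close> assms(4)] assms(10) unfolding G_def by blast
qed

end
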